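(* For each $P\in\mathcal{P}$, the set $\mathcal{G}_{lu,P}$ of locally universal groups in $\mathcal{G}_P$ is a comeager subset of $\mathcal{G}_P$.
   Context: An enumerated group is a group whose underlying set is $\mathbf{N}=\{1,2,3,\ldots\}$. The set $\mathcal{G}$ of enumerated groups is identified, via (multiplication, inversion, identity), with a subset of $\mathbf{N}^{\mathbf{N}\times\mathbf{N}}\times\mathbf{N}^{\mathbf{N}}\times\mathbf{N}$ (product topology, $\mathbf{N}$ discrete) and given the subspace topology; it is a Polish space. For a property $P$ of groups, $\mathcal{G}_P\subset\mathcal{G}$ is the subspace of enumerated groups satisfying $P$. A subset of a space is comeager if it contains a countable intersection of dense open subsets of that space. $\mathcal{P}$ is the following set of properties of groups: amenability; having no subgroup isomorphic to the free group $\mathbf{F}_2$; left orderability (existence of a left-invariant total order); local indicability (every nontrivial finitely generated subgroup has an infinite cyclic quotient); biorderability (existence of a total order invariant under left and right translation); the unique product property (for all nonempty finite subsets $X,Y$ there is an element that can be written as $xy$ with $x\in X,y\in Y$ in exactly one way); torsion-freeness; soficity; not satisfying a law (for every nontrivial freely reduced word $w$ there is a tuple $\vec a$ in the group with $w(\vec a)\neq e$). For each $P\in\mathcal{P}$ the space $\mathcal{G}_P$ is Polish. An enumerated group $H\in\mathcal{G}_P$ is locally universal for $\mathcal{G}_P$ if every group in $\mathcal{G}_P$ embeds into an ultrapower of $H$. $\mathcal{G}_{lu,P}$ denotes the set of all $H\in\mathcal{G}_P$ that are locally universal for $\mathcal{G}_P$. *)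

theory Defs
  imports
    "HOL-Analysis.Analysis"
    "HOL-Algebra.Product_Groups"
    "HOL-Algebra.Sym_Groups"
begin

text \<open>The letter \<open>(x, True)\<close> is the generator \<open>x\<close> and \<open>(x, False)\<close> is its formal inverse.\<close>

type_synonym 'x word = "('x \<times> bool) list"

definition inv_letter :: "'x \<times> bool \<Rightarrow> 'x \<times> bool" where
  "inv_letter l = (fst l, \<not> snd l)"

definition freely_reduced :: "'x word \<Rightarrow> bool" where
  "freely_reduced w \<longleftrightarrow> successively (\<lambda>l l'. l' \<noteq> inv_letter l) w"

text \<open>Left multiplication of a reduced word by a letter, followed by free reduction.\<close>

fun red_cons :: "'x \<times> bool \<Rightarrow> 'x word \<Rightarrow> 'x word" where
  "red_cons l [] = [l]"
| "red_cons l (l' # w) = (if l' = inv_letter l then w else l # l' # w)"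

definition free_group :: "'x word monoid" where
  "free_group = \<lparr>carrier = {w. freely_reduced w}, mult = (\<lambda>u v. foldr red_cons u v), one = []\<rparr>"

abbreviation free_group_2 :: "bool word monoid" where
  "free_group_2 \<equiv> free_group"

definition word_eval :: "('a, 'b) monoid_scheme \<Rightarrow> ('x \<Rightarrow> 'a) \<Rightarrow> 'x word \<Rightarrow> 'a" where
  "word_eval G a w =
     foldr (\<lambda>(x, b) y. (if b then a x else inv\<^bsub>G\<^esub> (a x)) \<otimes>\<^bsub>G\<^esub> y) w \<one>\<^bsub>G\<^esub>"

lemma inv_letter_inv_letter [simp]: "inv_letter (inv_letter l) = l"
  by (simp add: inv_letter_def)

lemma inv_letter_neq [simp]: "inv_letter l \<noteq> l"
  by (cases l) (simp add: inv_letter_def)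

lemma freely_reduced_Nil [simp]: "freely_reduced []"
  by (simp add: freely_reduced_def)

lemma freely_reduced_Cons:
  "freely_reduced (l # w) \<longleftrightarrow> freely_reduced w \<and> (w \<noteq> [] \<longrightarrow> hd w \<noteq> inv_letter l)"
  by (cases w) (auto simp: freely_reduced_def)

lemma freely_reduced_red_cons: "freely_reduced w \<Longrightarrow> freely_reduced (red_cons l w)"
  by (cases w) (auto simp: freely_reduced_Cons)

lemma red_cons_inv_letter:
  "freely_reduced w \<Longrightarrow> red_cons l (red_cons (inv_letter l) w) = w"
  by (cases w; cases "tl w") (auto simp: freely_reduced_Cons)

lemma freely_reduced_foldr: "freely_reduced v \<Longrightarrow> freely_reduced (foldr red_cons u v)"
  by (induction u) (auto simp: freely_reduced_red_cons)

lemma foldr_red_cons_red_cons: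
  assumes "freely_reduced v"
  shows "foldr red_cons (red_cons l u) v = red_cons l (foldr red_cons u v)"
proof (cases u)
  case (Cons l' u')
  show ?thesis
    using red_cons_inv_letter[OF freely_reduced_foldr[OF assms], of l u'] by (auto simp: Cons)
qed auto

lemma foldr_red_cons_assoc:
  assumes "freely_reduced w"
  shows "foldr red_cons (foldr red_cons u v) w = foldr red_cons u (foldr red_cons v w)"
  by (induction u) (auto simp: foldr_red_cons_red_cons assms)

lemma foldr_red_cons_Nil: "freely_reduced w \<Longrightarrow> foldr red_cons w [] = w"
proof (induction w)
  case (Cons l w)
  then show ?case by (cases w) (auto simp: freely_reduced_Cons)
qed auto

lemma group_free_group: "group (free_group :: 'x word monoid)"
proof (rule groupI)
  fix w :: "'x word"
  assume "w \<in> carrier free_group"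
  have inv: "foldr red_cons (rev (map inv_letter u)) (foldr red_cons u v) = v"
    if "freely_reduced v" for u v :: "'x word"
  proof (induction u)
    case (Cons l u)
    then show ?case
      using red_cons_inv_letter[OF freely_reduced_foldr[OF that], of "inv_letter l" u] by simp
  qed simp
  let ?v = "foldr red_cons (rev (map inv_letter w)) []"
  have w: "freely_reduced w"
    using \<open>w \<in> carrier free_group\<close> by (simp add: free_group_def)
  have "foldr red_cons ?v w = []"
    using inv[of "[]" w] foldr_red_cons_assoc[OF w, of "rev (map inv_letter w)" "[]"] w
    by (simp add: foldr_red_cons_Nil)
  then show "\<exists>v\<in>carrier free_group. v \<otimes>\<^bsub>free_group\<^esub> w = \<one>\<^bsub>free_group\<^esub>"
    by (intro bexI[of _ ?v]) (auto simp: free_group_def freely_reduced_foldr)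
qed (auto simp: free_group_def freely_reduced_foldr foldr_red_cons_assoc)

text \<open>
  An invariant mean is a normalized positive left-invariant linear functional on the bounded
  real-valued functions on the group. Functions live on the whole type; positivity and linearity
  make the value depend only on the restriction to the carrier.
\<close>

definition invariant_mean :: "('a, 'b) monoid_scheme \<Rightarrow> (('a \<Rightarrow> real) \<Rightarrow> real) \<Rightarrow> bool" where
  "invariant_mean G m \<longleftrightarrow>
     (\<forall>f g. bounded (f ` carrier G) \<longrightarrow> bounded (g ` carrier G) \<longrightarrow>
        m (\<lambda>x. f x + g x) = m f + m g) \<and>
     (\<forall>c f. bounded (f ` carrier G) \<longrightarrow> m (\<lambda>x. c * f x) = c * m f) \<and>
     (\<forall>f. bounded (f ` carrier G) \<longrightarrow> (\<forall>x\<in>carrier G. 0 \<le> f x) \<longrightarrow> 0 \<le> m f) \<and>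
     m (\<lambda>x. 1) = 1 \<and>
     (\<forall>g\<in>carrier G. \<forall>f. bounded (f ` carrier G) \<longrightarrow> m (\<lambda>x. f (g \<otimes>\<^bsub>G\<^esub> x)) = m f)"

definition amenable :: "('a, 'b) monoid_scheme \<Rightarrow> bool" where
  "amenable G \<longleftrightarrow> (\<exists>m. invariant_mean G m)"

definition no_free_subgroup :: "('a, 'b) monoid_scheme \<Rightarrow> bool" where
  "no_free_subgroup G \<longleftrightarrow> \<not> (\<exists>K. subgroup K G \<and> free_group_2 \<cong> G\<lparr>carrier := K\<rparr>)"

definition left_invariant :: "('a, 'b) monoid_scheme \<Rightarrow> ('a \<times> 'a) set \<Rightarrow> bool" where
  "left_invariant G r \<longleftrightarrow>
     (\<forall>g\<in>carrier G. \<forall>(x, y)\<in>r. (g \<otimes>\<^bsub>G\<^esub> x, g \<otimes>\<^bsub>G\<^esub> y) \<in> r)"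

definition right_invariant :: "('a, 'b) monoid_scheme \<Rightarrow> ('a \<times> 'a) set \<Rightarrow> bool" where
  "right_invariant G r \<longleftrightarrow>
     (\<forall>g\<in>carrier G. \<forall>(x, y)\<in>r. (x \<otimes>\<^bsub>G\<^esub> g, y \<otimes>\<^bsub>G\<^esub> g) \<in> r)"

definition left_orderable :: "('a, 'b) monoid_scheme \<Rightarrow> bool" where
  "left_orderable G \<longleftrightarrow> (\<exists>r. linear_order_on (carrier G) r \<and> left_invariant G r)"

definition biorderable :: "('a, 'b) monoid_scheme \<Rightarrow> bool" where
  "biorderable G \<longleftrightarrow>
     (\<exists>r. linear_order_on (carrier G) r \<and> left_invariant G r \<and> right_invariant G r)"

definition locally_indicable :: "('a, 'b) monoid_scheme \<Rightarrow> bool" where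
  "locally_indicable G \<longleftrightarrow>
     (\<forall>X. finite X \<longrightarrow> X \<subseteq> carrier G \<longrightarrow> generate G X \<noteq> {\<one>\<^bsub>G\<^esub>} \<longrightarrow>
        (\<exists>N. N \<lhd> G\<lparr>carrier := generate G X\<rparr> \<and>
             G\<lparr>carrier := generate G X\<rparr> Mod N \<cong> integer_group))"

definition unique_product :: "('a, 'b) monoid_scheme \<Rightarrow> bool" where
  "unique_product G \<longleftrightarrow>
     (\<forall>X Y. finite X \<longrightarrow> X \<noteq> {} \<longrightarrow> X \<subseteq> carrier G \<longrightarrow>
            finite Y \<longrightarrow> Y \<noteq> {} \<longrightarrow> Y \<subseteq> carrier G \<longrightarrow>
        (\<exists>z. \<exists>!p. p \<in> X \<times> Y \<and> z = fst p \<otimes>\<^bsub>G\<^esub> snd p))"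

definition torsion_free :: "('a, 'b) monoid_scheme \<Rightarrow> bool" where
  "torsion_free G \<longleftrightarrow>
     (\<forall>x\<in>carrier G. x \<noteq> \<one>\<^bsub>G\<^esub> \<longrightarrow> (\<forall>n::nat. n > 0 \<longrightarrow> x [^]\<^bsub>G\<^esub> n \<noteq> \<one>\<^bsub>G\<^esub>))"

text \<open>Normalized Hamming distance; \<open>sym_group n\<close> acts on \<open>{1..n}\<close>.\<close>

definition hamming_dist :: "nat \<Rightarrow> (nat \<Rightarrow> nat) \<Rightarrow> (nat \<Rightarrow> nat) \<Rightarrow> real" where
  "hamming_dist n p q = real (card {i \<in> {1..n}. p i \<noteq> q i}) / real n"

definition sofic :: "('a, 'b) monoid_scheme \<Rightarrow> bool" where
  "sofic G \<longleftrightarrow>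
     (\<forall>F \<epsilon>. finite F \<longrightarrow> F \<subseteq> carrier G \<longrightarrow> \<epsilon> > 0 \<longrightarrow>
        (\<exists>n>0. \<exists>\<phi> \<in> carrier G \<rightarrow> carrier (sym_group n).
           (\<forall>g\<in>F. \<forall>h\<in>F. hamming_dist n (\<phi> (g \<otimes>\<^bsub>G\<^esub> h)) (\<phi> g \<circ> \<phi> h) < \<epsilon>) \<and>
           (\<forall>g\<in>F. g \<noteq> \<one>\<^bsub>G\<^esub> \<longrightarrow> hamming_dist n (\<phi> g) id > 1 - \<epsilon>)))"

text \<open>
  The variables of a law are natural numbers, so all finite numbers of variables are covered; only
  the values of the assignment at the variables occurring in the word matter.
\<close>

definition satisfies_no_law :: "('a, 'b) monoid_scheme \<Rightarrow> bool" where
  "satisfies_no_law G \<longleftrightarrow>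
     (\<forall>w :: nat word. freely_reduced w \<longrightarrow> w \<noteq> [] \<longrightarrow>
        (\<exists>a \<in> UNIV \<rightarrow> carrier G. word_eval G a w \<noteq> \<one>\<^bsub>G\<^esub>))"

definition group_properties :: "(nat monoid \<Rightarrow> bool) set" where
  "group_properties =
     {amenable, no_free_subgroup, left_orderable, locally_indicable, biorderable,
      unique_product, torsion_free, sofic, satisfies_no_law}"

definition ultrafilter :: "'i filter \<Rightarrow> bool" where
  "ultrafilter U \<longleftrightarrow>
     U \<noteq> bot \<and> (\<forall>A. eventually A U \<or> eventually (\<lambda>i. \<not> A i) U)"

definition ultrapower :: "'i filter \<Rightarrow> ('a, 'b) monoid_scheme \<Rightarrow> ('i \<Rightarrow> 'a) set monoid" where
  "ultrapower U G =
     product_group UNIV (\<lambda>_. G) Mod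
       {f \<in> carrier (product_group UNIV (\<lambda>_. G)). eventually (\<lambda>i. f i = \<one>\<^bsub>G\<^esub>) U}"

text \<open>
  The type \<open>nat\<close> plays the role of the countably infinite discrete set underlying all enumerated
  groups. The function and product types carry the product topology.
\<close>

type_synonym enum_structure = "(nat \<times> nat \<Rightarrow> nat) \<times> (nat \<Rightarrow> nat) \<times> nat"

definition to_group :: "enum_structure \<Rightarrow> nat monoid" where
  "to_group s =
     \<lparr>carrier = UNIV, mult = (\<lambda>x y. fst s (x, y)), one = snd (snd s)\<rparr>"

definition enumerated_groups :: "enum_structure set" where
  "enumerated_groups =
     {s. group (to_group s) \<and> (\<forall>x. fst (snd s) x = inv\<^bsub>to_group s\<^esub> x)}"

definition enumerated_groups_with :: "(nat monoid \<Rightarrow> bool) \<Rightarrow> enum_structure set" where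
  "enumerated_groups_with P = {s \<in> enumerated_groups. P (to_group s)}"

text \<open>
  Index sets of ultrapowers are taken to be \<open>nat\<close>; by the lemma \<open>embeds_ultrapower_nat\<close> below
  this is no restriction, since the embedded groups are countable.
\<close>

definition locally_universal :: "(nat monoid \<Rightarrow> bool) \<Rightarrow> enum_structure \<Rightarrow> bool" where
  "locally_universal P h \<longleftrightarrow>
     (\<forall>g \<in> enumerated_groups_with P. \<exists>U :: nat filter. ultrafilter U \<and>
        mon (to_group g) (ultrapower U (to_group h)) \<noteq> {})"

definition locally_universal_groups :: "(nat monoid \<Rightarrow> bool) \<Rightarrow> enum_structure set" where
  "locally_universal_groups P = {h \<in> enumerated_groups_with P. locally_universal P h}"

definition comeager_in :: "'a topology \<Rightarrow> 'a set \<Rightarrow> bool" where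
  "comeager_in X A \<longleftrightarrow>
     A \<subseteq> topspace X \<and>
     (\<exists>\<U>. countable \<U> \<and> (\<forall>V\<in>\<U>. openin X V \<and> X closure_of V = topspace X) \<and>
          topspace X \<inter> \<Inter>\<U> \<subseteq> A)"

lemma normal_ultrapower_kernel:
  assumes "group G"
  shows "{f \<in> carrier (product_group UNIV (\<lambda>_. G)). eventually (\<lambda>i. f i = \<one>\<^bsub>G\<^esub>) U}
           \<lhd> product_group UNIV (\<lambda>_. G)" (is "?N \<lhd> ?P")
proof -
  interpret G: group G by fact
  interpret P: group ?P by (intro product_group assms)
  have "subgroup ?N ?P"
  proof (rule P.subgroupI)
    fix f assume "f \<in> ?N"
    then show "inv\<^bsub>?P\<^esub> f \<in> ?N"
      using G.inv_closed by (auto simp: assms PiE_iff elim!: eventually_mono)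
  next
    fix f g assume "f \<in> ?N" "g \<in> ?N"
    then show "f \<otimes>\<^bsub>?P\<^esub> g \<in> ?N"
      by (auto simp: PiE_iff elim: eventually_elim2)
  qed (auto intro!: exI[of _ "\<lambda>_. \<one>\<^bsub>G\<^esub>"])
  moreover have "f \<otimes>\<^bsub>?P\<^esub> g \<otimes>\<^bsub>?P\<^esub> inv\<^bsub>?P\<^esub> f \<in> ?N" if "f \<in> carrier ?P" "g \<in> ?N" for f g
  proof -
    have "eventually (\<lambda>i. g i = \<one>\<^bsub>G\<^esub>) U" using that by auto
    then have "eventually (\<lambda>i. f i \<otimes>\<^bsub>G\<^esub> g i \<otimes>\<^bsub>G\<^esub> inv\<^bsub>G\<^esub> f i = \<one>\<^bsub>G\<^esub>) U"
      by eventually_elim (use that in \<open>auto simp: PiE_iff\<close>)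
    then show ?thesis using that by (auto simp: PiE_iff assms)
  qed
  ultimately show ?thesis
    unfolding P.normal_inv_iff by blast
qed

text \<open>
  Embeddings into an ultrapower are the same as families of maps into the group that satisfy each
  single multiplicativity and injectivity requirement almost everywhere.
\<close>

lemma embeds_ultrapower_iff:
  fixes G :: "('a, 'c) monoid_scheme" and H :: "('b, 'd) monoid_scheme" and U :: "'i filter"
  assumes G: "group G" and H: "group H" and U: "ultrafilter U"
  shows "mon G (ultrapower U H) \<noteq> {} \<longleftrightarrow>
    (\<exists>h :: 'i \<Rightarrow> 'a \<Rightarrow> 'b. (\<forall>i. h i \<in> carrier G \<rightarrow> carrier H) \<and>
       (\<forall>a\<in>carrier G. \<forall>b\<in>carrier G.
          eventually (\<lambda>i. h i (a \<otimes>\<^bsub>G\<^esub> b) = h i a \<otimes>\<^bsub>H\<^esub> h i b) U) \<and>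
       (\<forall>a\<in>carrier G. a \<noteq> \<one>\<^bsub>G\<^esub> \<longrightarrow> eventually (\<lambda>i. h i a \<noteq> \<one>\<^bsub>H\<^esub>) U))"
    (is "_ \<longleftrightarrow> ?R")
proof -
  interpret G: group G by fact
  interpret H: group H by fact
  define Q where "Q = product_group (UNIV :: 'i set) (\<lambda>_. H)"
  define N where "N = {f \<in> carrier Q. eventually (\<lambda>i. f i = \<one>\<^bsub>H\<^esub>) U}"
  have "group Q" unfolding Q_def by (intro product_group H)
  then interpret Q: group Q .
  have N: "N \<lhd> Q" unfolding N_def Q_def by (rule normal_ultrapower_kernel[OF H])
  then interpret N: normal N Q .
  have up: "ultrapower U H = Q Mod N" unfolding ultrapower_def N_def Q_def ..
  have carQ: "f \<in> carrier Q \<longleftrightarrow> (\<forall>i. f i \<in> carrier H)" for f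
    by (auto simp: Q_def PiE_iff)
  have multQ: "f \<otimes>\<^bsub>Q\<^esub> g = (\<lambda>i. f i \<otimes>\<^bsub>H\<^esub> g i)" for f g
    by (simp add: Q_def restrict_def)
  have oneQ: "\<one>\<^bsub>Q\<^esub> = (\<lambda>i. \<one>\<^bsub>H\<^esub>)"
    by (simp add: Q_def restrict_def)
  have invQ: "inv\<^bsub>Q\<^esub> f = (\<lambda>i. inv\<^bsub>H\<^esub> f i)" if "f \<in> carrier Q" for f
    using that unfolding Q_def by (subst inv_product_group) (auto simp: H restrict_def)
  have coset_eq: "N #>\<^bsub>Q\<^esub> f = N #>\<^bsub>Q\<^esub> g \<longleftrightarrow> eventually (\<lambda>i. f i = g i) U"
    if f: "f \<in> carrier Q" and g: "g \<in> carrier Q" for f g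
  proof -
    have "N #>\<^bsub>Q\<^esub> f = N #>\<^bsub>Q\<^esub> g \<longleftrightarrow> f \<in> N #>\<^bsub>Q\<^esub> g"
      using Q.repr_independence[OF _ g N.subgroup_axioms] Q.rcos_self[OF f N.subgroup_axioms]
      by blast
    also have "\<dots> \<longleftrightarrow> f \<otimes>\<^bsub>Q\<^esub> inv\<^bsub>Q\<^esub> g \<in> N"
      using N.rcos_module[OF Q.group_axioms g f] by simp
    also have "\<dots> \<longleftrightarrow> eventually (\<lambda>i. f i \<otimes>\<^bsub>H\<^esub> inv\<^bsub>H\<^esub> g i = \<one>\<^bsub>H\<^esub>) U"
      using f g by (auto simp: N_def multQ invQ carQ)
    also have "\<dots> \<longleftrightarrow> eventually (\<lambda>i. f i = g i) U"
      by (rule arg_cong[where f = "\<lambda>A. eventually A U"], rule ext)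
         (use f g H.inv_solve_right'[of "\<one>\<^bsub>H\<^esub>"] in \<open>auto simp: carQ\<close>)
    finally show ?thesis .
  qed
  show ?thesis
  proof
    assume "mon G (ultrapower U H) \<noteq> {}"
    then obtain \<phi> where hom: "\<phi> \<in> hom G (Q Mod N)" and inj: "inj_on \<phi> (carrier G)"
      by (auto simp: up mon_def)
    have "\<exists>f \<in> carrier Q. \<phi> a = N #>\<^bsub>Q\<^esub> f" if "a \<in> carrier G" for a
      using hom_in_carrier[OF hom that] by (auto simp: FactGroup_def RCOSETS_def)
    then obtain f where f: "\<And>a. a \<in> carrier G \<Longrightarrow> f a \<in> carrier Q"
      and \<phi>: "\<And>a. a \<in> carrier G \<Longrightarrow> \<phi> a = N #>\<^bsub>Q\<^esub> f a"
      by metis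
    have "eventually (\<lambda>i. f (a \<otimes>\<^bsub>G\<^esub> b) i = f a i \<otimes>\<^bsub>H\<^esub> f b i) U"
      if a: "a \<in> carrier G" and b: "b \<in> carrier G" for a b
    proof -
      have "N #>\<^bsub>Q\<^esub> f (a \<otimes>\<^bsub>G\<^esub> b) = \<phi> a \<otimes>\<^bsub>Q Mod N\<^esub> \<phi> b"
        using hom_mult[OF hom a b] a b by (simp add: \<phi>)
      also have "\<dots> = N #>\<^bsub>Q\<^esub> (f a \<otimes>\<^bsub>Q\<^esub> f b)"
        using a b by (simp add: \<phi> f N.rcos_sum FactGroup_def)
      finally show ?thesis
        using coset_eq[of "f (a \<otimes>\<^bsub>G\<^esub> b)" "f a \<otimes>\<^bsub>Q\<^esub> f b"] f a b
        by (simp del: N.rcos_sum) (simp add: multQ)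
    qed
    moreover have "eventually (\<lambda>i. f a i \<noteq> \<one>\<^bsub>H\<^esub>) U"
      if a: "a \<in> carrier G" and "a \<noteq> \<one>\<^bsub>G\<^esub>" for a
    proof -
      have "\<phi> a \<noteq> \<phi> \<one>\<^bsub>G\<^esub>"
        using inj that by (auto dest: inj_onD)
      moreover have "\<phi> \<one>\<^bsub>G\<^esub> = N #>\<^bsub>Q\<^esub> \<one>\<^bsub>Q\<^esub>"
        using hom_one[OF hom G.group_axioms N.factorgroup_is_group] N.subset
        by (simp add: FactGroup_def)
      ultimately have "\<not> eventually (\<lambda>i. f a i = \<one>\<^bsub>H\<^esub>) U"
        using a f coset_eq[OF f[OF a] Q.one_closed] by (simp add: \<phi> oneQ)
      then show ?thesis
        using U unfolding ultrafilter_def by blast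
    qed
    ultimately show ?R
      using f by (intro exI[of _ "\<lambda>i a. f a i"] conjI) (simp_all add: carQ)
  next
    assume ?R
    then obtain h where h': "\<And>i. h i \<in> carrier G \<rightarrow> carrier H"
      and mult: "\<And>a b. a \<in> carrier G \<Longrightarrow> b \<in> carrier G \<Longrightarrow>
          eventually (\<lambda>i. h i (a \<otimes>\<^bsub>G\<^esub> b) = h i a \<otimes>\<^bsub>H\<^esub> h i b) U"
      and ne: "\<And>a. a \<in> carrier G \<Longrightarrow> a \<noteq> \<one>\<^bsub>G\<^esub> \<Longrightarrow> eventually (\<lambda>i. h i a \<noteq> \<one>\<^bsub>H\<^esub>) U"
      by blast
    have h: "h i a \<in> carrier H" if "a \<in> carrier G" for i a
      using h' that by auto
    define \<phi> where "\<phi> = (\<lambda>a. N #>\<^bsub>Q\<^esub> (\<lambda>i. h i a))"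
    have car: "(\<lambda>i. h i a) \<in> carrier Q" if "a \<in> carrier G" for a
      using that h by (simp add: carQ)
    have hom: "\<phi> \<in> hom G (Q Mod N)"
    proof (rule homI)
      fix a assume "a \<in> carrier G"
      then show "\<phi> a \<in> carrier (Q Mod N)"
        using car by (auto simp: \<phi>_def FactGroup_def RCOSETS_def)
    next
      fix a b assume a: "a \<in> carrier G" and b: "b \<in> carrier G"
      have "\<phi> (a \<otimes>\<^bsub>G\<^esub> b) = N #>\<^bsub>Q\<^esub> ((\<lambda>i. h i a) \<otimes>\<^bsub>Q\<^esub> (\<lambda>i. h i b))"
        unfolding \<phi>_def using coset_eq[of "\<lambda>i. h i (a \<otimes>\<^bsub>G\<^esub> b)"] mult[OF a b] a b car
        by (simp add: multQ carQ h)
      also have "\<dots> = \<phi> a \<otimes>\<^bsub>Q Mod N\<^esub> \<phi> b"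
        using a b car by (simp add: \<phi>_def N.rcos_sum FactGroup_def)
      finally show "\<phi> (a \<otimes>\<^bsub>G\<^esub> b) = \<phi> a \<otimes>\<^bsub>Q Mod N\<^esub> \<phi> b" .
    qed
    have "group_hom G (Q Mod N) \<phi>"
      using hom N.factorgroup_is_group G by (simp add: group_hom_def group_hom_axioms_def)
    moreover have "a = \<one>\<^bsub>G\<^esub>" if a: "a \<in> carrier G" and "\<phi> a = \<one>\<^bsub>Q Mod N\<^esub>" for a
    proof (rule ccontr)
      assume "a \<noteq> \<one>\<^bsub>G\<^esub>"
      have "N #>\<^bsub>Q\<^esub> (\<lambda>i. h i a) = N #>\<^bsub>Q\<^esub> \<one>\<^bsub>Q\<^esub>"
        using that N.subset by (simp add: \<phi>_def FactGroup_def)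
      then have "eventually (\<lambda>i. h i a = \<one>\<^bsub>H\<^esub>) U"
        using coset_eq[OF car[OF a] Q.one_closed] by (simp add: oneQ)
      with ne[OF a \<open>a \<noteq> \<one>\<^bsub>G\<^esub>\<close>] have "eventually (\<lambda>i. False) U"
        by eventually_elim simp
      then show False
        using U by (simp add: ultrafilter_def trivial_limit_def)
    qed
    ultimately have "inj_on \<phi> (carrier G)"
      by (simp add: group_hom.inj_on_one_iff)
    with hom show "mon G (ultrapower U H) \<noteq> {}"
      by (auto simp: up mon_def)
  qed
qed

lemma embeds_ultrapower_nat:
  fixes G :: "nat monoid" and H :: "('b, 'd) monoid_scheme" and U :: "'i filter"
  assumes G: "group G" and H: "group H" and U: "ultrafilter U"
    and emb: "mon G (ultrapower U H) \<noteq> {}"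
  shows "\<exists>V :: nat filter. ultrafilter V \<and> mon G (ultrapower V H) \<noteq> {}"
proof -
  obtain h where h: "\<And>i. h i \<in> carrier G \<rightarrow> carrier H"
    and mult: "\<And>a b. a \<in> carrier G \<Longrightarrow> b \<in> carrier G \<Longrightarrow>
          eventually (\<lambda>i. h i (a \<otimes>\<^bsub>G\<^esub> b) = h i a \<otimes>\<^bsub>H\<^esub> h i b) U"
    and ne: "\<And>a. a \<in> carrier G \<Longrightarrow> a \<noteq> \<one>\<^bsub>G\<^esub> \<Longrightarrow> eventually (\<lambda>i. h i a \<noteq> \<one>\<^bsub>H\<^esub>) U"
    using emb unfolding embeds_ultrapower_iff[OF G H U] by blast
  define good where "good i a b \<longleftrightarrow>
      (a \<in> carrier G \<and> b \<in> carrier G \<longrightarrow> h i (a \<otimes>\<^bsub>G\<^esub> b) = h i a \<otimes>\<^bsub>H\<^esub> h i b) \<and>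
      (a \<in> carrier G \<and> a \<noteq> \<one>\<^bsub>G\<^esub> \<longrightarrow> h i a \<noteq> \<one>\<^bsub>H\<^esub>)" for i a b
  have good: "eventually (\<lambda>i. good i a b) U" for a b
    unfolding good_def using mult[of a b] ne[of a]
    by (cases "a \<in> carrier G"; cases "b \<in> carrier G"; cases "a = \<one>\<^bsub>G\<^esub>")
       (auto intro: eventually_conj)
  have "\<exists>(V :: nat filter) j. ultrafilter V \<and> (\<forall>a b. eventually (\<lambda>n. good (j n) a b) V)"
  proof (cases "\<exists>i. \<forall>a b. good i a b")
    case True
    then obtain i where "\<And>a b. good i a b" by blast
    then show ?thesis
      by (intro exI[of _ "principal {0}"] exI[of _ "\<lambda>_. i"])
         (auto simp: ultrafilter_def eventually_principal principal_eq_bot_iff)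
  next
    case False
    define k where "k i = (LEAST n. \<exists>a\<le>n. \<exists>b\<le>n. \<not> good i a b)" for i
    have k: "good i a b" if "a < k i" "b < k i" for i a b
    proof -
      have "max a b < k i" using that by simp
      then have "\<not> (\<exists>c\<le>max a b. \<exists>d\<le>max a b. \<not> good i c d)"
        unfolding k_def by (rule not_less_Least)
      then show ?thesis by (meson max.cobounded1 max.cobounded2)
    qed
    have le: "n \<le> k i" if "\<And>a b. a < n \<Longrightarrow> b < n \<Longrightarrow> good i a b" for i n
    proof -
      have "\<exists>n. \<exists>a\<le>n. \<exists>b\<le>n. \<not> good i a b"
        using False by (meson nat_le_linear)
      then have "\<exists>a\<le>k i. \<exists>b\<le>k i. \<not> good i a b"
        unfolding k_def by (rule LeastI_ex)
      then show ?thesis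
        using that by (meson le_less_trans not_le_imp_less)
    qed
    define j where "j n = (SOME i. k i = n)" for n
    have j: "k (j (k i)) = k i" for i
      unfolding j_def by (rule someI[of _ i]) simp
    have "eventually (\<lambda>n. good (j n) a b) (filtermap k U)" for a b
    proof -
      have "eventually (\<lambda>i. \<forall>c\<in>{..max a b}. \<forall>d\<in>{..max a b}. good i c d) U"
        by (intro eventually_ball_finite ballI good) auto
      then have "eventually (\<lambda>i. Suc (max a b) \<le> k i) U"
        by eventually_elim (auto intro: le)
      then show ?thesis
        unfolding eventually_filtermap
        by eventually_elim (use j in \<open>auto intro!: k\<close>)
    qed
    moreover have "ultrafilter (filtermap k U)"
      using U by (simp add: ultrafilter_def eventually_filtermap filtermap_bot_iff)
    ultimately show ?thesis by blast
  qed
  then obtain V :: "nat filter" and j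
    where V: "ultrafilter V" and good_V: "\<And>a b. eventually (\<lambda>n. good (j n) a b) V"
    by blast
  have "mon G (ultrapower V H) \<noteq> {}"
    unfolding embeds_ultrapower_iff[OF G H V]
  proof (intro exI[of _ "\<lambda>n. h (j n)"] conjI allI ballI impI)
    fix a b assume "a \<in> carrier G" "b \<in> carrier G"
    then show "eventually (\<lambda>n. h (j n) (a \<otimes>\<^bsub>G\<^esub> b) = h (j n) a \<otimes>\<^bsub>H\<^esub> h (j n) b) V"
      using good_V[of a b] by (auto simp: good_def elim: eventually_mono)
  next
    fix a assume "a \<in> carrier G" "a \<noteq> \<one>\<^bsub>G\<^esub>"
    then show "eventually (\<lambda>n. h (j n) a \<noteq> \<one>\<^bsub>H\<^esub>) V"
      using good_V[of a a] by (auto simp: good_def elim: eventually_mono)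
  qed (use h in auto)
  with V show ?thesis by blast
qed

end

theory Submission
  imports Defs
begin

text \<open>
  All the properties in question share one feature: if two groups have the property, then so does
  their direct product. This alone makes the generic group locally universal.

  A finite system consists of finitely many equations \<open>x y = z\<close> and inequations \<open>x \<noteq> e\<close> between
  variables. A countable group \<open>G\<close> embeds into some ultrapower of \<open>H\<close> as soon as every finite system
  solvable in \<open>G\<close> is solvable in \<open>H\<close>: the finite pieces of the multiplication table of \<open>G\<close> are such
  systems, and the ultraproduct of their solutions is an embedding
  (\<open>locally_universal_if_solvable\<close>). So \<open>H\<close> is locally universal when it solves every finite system
  that some group with the property solves. There are only countably many finite systems, and
  each is solvable on an open set of groups (\<open>open_solvable_in\<close>).

  This open set is dense when the system is solvable in some \<open>G\<close> with the property. A basic open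
  neighbourhood of a group \<open>H\<close> prescribes only finitely many entries of its tables. The elements of
  \<open>H \<times> G\<close> can be numbered so that the finitely many elements of \<open>H\<close> involved keep their numbers
  (\<open>enumerate_product\<close>). The resulting group lies in the neighbourhood, solves the system inside
  the factor \<open>G\<close>, and has the property by closure under products.

  Closure is proved property by property: orders combine lexicographically, the means of the
  two factors are applied in turn, and sofic approximations act on products of finite
  sets. The one case with combinatorial content is the absence of free subgroups: a free
  subgroup of rank two of the product that embeds into neither factor meets the kernels of both
  projections nontrivially, these kernels commute elementwise, yet two nontrivial elements of a
  free group of rank two always have conjugates that do not commute
  (\<open>free_group_conjugates_not_commuting\<close>).
\<close>

section \<open>Ultrafilters\<close>

text \<open>
  The ultrafilters below \<open>F\<close> are the minimal proper filters below \<open>F\<close>, which exist by Zorn's lemma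
  because the infimum of a nonempty chain of proper filters is proper. It is applied to the
  sequential filter, which yields nonprincipal ultrafilters.
\<close>

lemma ultrafilter_below:
  fixes F :: "'i filter"
  assumes "F \<noteq> bot"
  shows "\<exists>U\<le>F. ultrafilter U"
proof -
  define A where "A = {U. U \<noteq> bot \<and> U \<le> F}"
  have "\<exists>m\<in>A. \<forall>a\<in>A. m \<ge> a \<longrightarrow> a = m"
  proof (rule predicate_Zorn)
    show "partial_order_on A (relation_of (\<ge>) A)"
      by (auto simp: order_on_defs relation_of_def refl_on_def trans_def antisym_def)
  next
    fix C assume C: "C \<in> Chains (relation_of (\<ge>) A)"
    then have CA: "C \<subseteq> A"
      by (auto simp: Chains_def relation_of_def)
    have chain: "\<exists>x\<in>C. x \<le> inf U V" if "U \<in> C" "V \<in> C" for U V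
      using C that by (auto simp: Chains_def relation_of_def inf.absorb1 inf.absorb2)
    show "\<exists>u\<in>A. \<forall>a\<in>C. a \<ge> u"
    proof (cases "C = {}")
      case True
      then show ?thesis using assms by (auto simp: A_def)
    next
      case False
      then have "Inf C \<noteq> bot"
        using eventually_Inf_base[OF False chain, of "\<lambda>_. False"] CA
        by (auto simp: trivial_limit_def A_def)
      moreover obtain U where "U \<in> C" using False by blast
      then have "Inf C \<le> F"
        using CA by (auto simp: A_def intro: Inf_lower2)
      ultimately show ?thesis
        by (intro bexI[of _ "Inf C"]) (auto simp: A_def intro: Inf_lower)
    qed
  qed
  then obtain U where U: "U \<noteq> bot" "U \<le> F"
    and min: "\<And>V. V \<noteq> bot \<Longrightarrow> V \<le> F \<Longrightarrow> V \<le> U \<Longrightarrow> V = U"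
    by (auto simp: A_def)
  have "eventually S U \<or> eventually (\<lambda>i. \<not> S i) U" for S
  proof (rule disjCI)
    \<comment> \<open>Restricting a minimal filter to a set that it does not exclude cannot make it smaller.\<close>
    assume "\<not> eventually (\<lambda>i. \<not> S i) U"
    then have "inf U (principal {i. S i}) \<noteq> bot"
      by (simp add: trivial_limit_def eventually_inf_principal)
    then have "inf U (principal {i. S i}) = U"
      using U by (intro min) (auto intro: le_infI1)
    then have "U \<le> principal {i. S i}"
      by (metis inf.cobounded2)
    then show "eventually S U"
      by (simp add: le_principal)
  qed
  then show ?thesis
    using U by (auto simp: ultrafilter_def)
qed

section \<open>Finite systems of equations and inequations\<close>

text \<open>
  Equations of the form \<open>x y = z\<close> suffice, since any finite part of a multiplication table can be
  written with them; inequations \<open>x \<noteq> e\<close> suffice for injectivity of a homomorphism.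
\<close>

definition solvable_in :: "(nat \<times> nat \<times> nat) set \<Rightarrow> nat set \<Rightarrow> ('a, 'b) monoid_scheme \<Rightarrow> bool"
  where "solvable_in E I G \<longleftrightarrow>
    (\<exists>k. (\<forall>x. k x \<in> carrier G) \<and> (\<forall>(x, y, z)\<in>E. k x \<otimes>\<^bsub>G\<^esub> k y = k z) \<and> (\<forall>x\<in>I. k x \<noteq> \<one>\<^bsub>G\<^esub>))"

lemma to_group_simps [simp]:
  "carrier (to_group s) = UNIV"
  "x \<otimes>\<^bsub>to_group s\<^esub> y = fst s (x, y)"
  "\<one>\<^bsub>to_group s\<^esub> = snd (snd s)"
  by (simp_all add: to_group_def)

text \<open>
  Whether a given assignment solves the system depends on finitely many entries of the tables, so
  this is an open condition; solvability is the union over all assignments.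
\<close>

lemma open_solvable_in:
  assumes "finite E" "finite I"
  shows "open {s. solvable_in E I (to_group s)}"
proof -
  have *: "{s :: enum_structure. solvable_in E I (to_group s)} =
    (\<Union>k. (\<Inter>e\<in>E. {s. fst s (k (fst e), k (fst (snd e))) = k (snd (snd e))}) \<inter>
      (\<Inter>x\<in>I. {s. k x \<noteq> snd (snd s)}))"
    by (simp add: solvable_in_def set_eq_iff split_beta)
  have "continuous_on UNIV (\<lambda>f :: nat \<times> nat \<Rightarrow> nat. f (x, y))" for x y
    by (rule continuous_on_product_coordinates)
  then have "continuous_on UNIV (\<lambda>s::enum_structure. fst s (x, y))" for x y
    by (rule continuous_on_compose2) (auto intro: continuous_on_fst continuous_on_id)
  then have "open ((\<lambda>s::enum_structure. fst s (x, y)) -` {z})" for x y z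
    by (rule open_vimage[OF open_discrete])
  moreover have "continuous_on UNIV (\<lambda>s::enum_structure. snd (snd s))"
    by (intro continuous_on_snd continuous_on_id)
  then have "open ((\<lambda>s::enum_structure. snd (snd s)) -` (- {z}))" for z
    by (rule open_vimage[OF open_discrete])
  ultimately show ?thesis
    using assms unfolding * vimage_def
    by (intro open_UN open_Int open_INT ballI) (simp_all add: eq_commute)
qed

text \<open>
  The multiplication table of \<open>g\<close> on \<open>{..n}\<close> is a system solved in \<open>g\<close> by the identity. Its solutions
  in \<open>h\<close> for growing \<open>n\<close> meet each single requirement of an embedding for almost all \<open>n\<close>, hence
  almost everywhere for a nonprincipal ultrafilter.
\<close>

lemma locally_universal_if_solvable:
  assumes h: "h \<in> enumerated_groups"
    and sol: "\<And>E I g. finite E \<Longrightarrow> finite I \<Longrightarrow> g \<in> enumerated_groups_with P \<Longrightarrow>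
      solvable_in E I (to_group g) \<Longrightarrow> solvable_in E I (to_group h)"
  shows "locally_universal P h"
  unfolding locally_universal_def
proof
  obtain U :: "nat filter" where U: "ultrafilter U" and le: "U \<le> sequentially"
    using ultrafilter_below[OF sequentially_bot] by blast
  have late: "eventually (\<lambda>i. n \<le> i) U" for n
    using le eventually_ge_at_top by (rule filter_leD)
  fix g assume g: "g \<in> enumerated_groups_with P"
  define E where "E n = (\<lambda>(x, y). (x, y, fst g (x, y))) ` ({..n} \<times> {..n})" for n
  define I where "I n = {..n} - {snd (snd g)}" for n
  have "solvable_in (E n) (I n) (to_group h)" for n
  proof (rule sol[OF _ _ g])
    show "solvable_in (E n) (I n) (to_group g)"
      unfolding solvable_in_def by (rule exI[of _ id]) (auto simp: E_def I_def)
  qed (auto simp: E_def I_def)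
  then have "\<exists>k. \<forall>n. (\<forall>(x, y, z)\<in>E n. fst h (k n x, k n y) = k n z) \<and> (\<forall>x\<in>I n. k n x \<noteq> snd (snd h))"
    by (intro choice allI) (simp add: solvable_in_def)
  then obtain k where k: "\<And>n x y z. (x, y, z) \<in> E n \<Longrightarrow> fst h (k n x, k n y) = k n z"
      "\<And>n x. x \<in> I n \<Longrightarrow> k n x \<noteq> snd (snd h)"
    by fast
  have "mon (to_group g) (ultrapower U (to_group h)) \<noteq> {}"
  proof (subst embeds_ultrapower_iff)
    show "group (to_group g)" "group (to_group h)" "ultrafilter U"
      using g h U by (auto simp: enumerated_groups_with_def enumerated_groups_def)
    have "eventually (\<lambda>i. k i (fst g (a, b)) = fst h (k i a, k i b)) U" for a b
      using late[of "max a b"]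
      by eventually_elim (intro k(1)[symmetric], auto simp: E_def)
    moreover have "eventually (\<lambda>i. k i a \<noteq> snd (snd h)) U" if "a \<noteq> snd (snd g)" for a
      using late[of a] by eventually_elim (intro k(2), use that in \<open>auto simp: I_def\<close>)
    ultimately show "\<exists>k. (\<forall>i. k i \<in> carrier (to_group g) \<rightarrow> carrier (to_group h)) \<and>
       (\<forall>a\<in>carrier (to_group g). \<forall>b\<in>carrier (to_group g).
          eventually (\<lambda>i. k i (a \<otimes>\<^bsub>to_group g\<^esub> b) = k i a \<otimes>\<^bsub>to_group h\<^esub> k i b) U) \<and>
       (\<forall>a\<in>carrier (to_group g). a \<noteq> \<one>\<^bsub>to_group g\<^esub> \<longrightarrow>
          eventually (\<lambda>i. k i a \<noteq> \<one>\<^bsub>to_group h\<^esub>) U)"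
      by (intro exI[of _ k]) auto
  qed
  then show "\<exists>U :: nat filter. ultrafilter U \<and> mon (to_group g) (ultrapower U (to_group h)) \<noteq> {}"
    using U by blast
qed

section \<open>Direct products of enumerated groups\<close>

text \<open>
  \<open>K\<close> is the internal direct product of copies of \<open>G\<close> and \<open>H\<close>, given by the two projections.
  Enumerated groups have a fixed underlying set, so their products occur only after renumbering;
  proving closure under products for every such \<open>K\<close> includes invariance under isomorphism.
\<close>

locale direct_decomposition = K: group K + G: group G + H: group H
  for K :: "('a, 'k) monoid_scheme" and G :: "('b, 'g) monoid_scheme"
    and H :: "('c, 'h) monoid_scheme" +
  fixes p :: "'a \<Rightarrow> 'b" and q :: "'a \<Rightarrow> 'c"
  assumes p_hom: "p \<in> hom K G" and q_hom: "q \<in> hom K H"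
    and bij: "bij_betw (\<lambda>x. (p x, q x)) (carrier K) (carrier G \<times> carrier H)"
begin

sublocale p: group_hom K G p
  by unfold_locales (rule p_hom)

sublocale q: group_hom K H q
  by unfold_locales (rule q_hom)

lemma eqI:
  assumes "x \<in> carrier K" "y \<in> carrier K" "p x = p y" "q x = q y"
  shows "x = y"
  using bij assms by (auto simp: bij_betw_def dest: inj_onD)

lemma obtain_element:
  assumes "g \<in> carrier G" "h \<in> carrier H"
  obtains x where "x \<in> carrier K" "p x = g" "q x = h"
proof -
  have "(g, h) \<in> (\<lambda>x. (p x, q x)) ` carrier K"
    using bij assms by (simp add: bij_betw_def)
  then show thesis using that by auto
qed

end

text \<open>
  The complements of the finite sets \<open>B\<close> and \<open>f ` B\<close> are both countably infinite, so any bijection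
  between them completes \<open>f\<close>.
\<close>

lemma finite_inj_extends_to_bij:
  fixes f :: "'a::countable \<Rightarrow> 'b::countable"
  assumes "infinite (UNIV :: 'a set)" "infinite (UNIV :: 'b set)" and B: "finite B" "inj_on f B"
  obtains e where "bij e" "\<And>x. x \<in> B \<Longrightarrow> e x = f x"
proof -
  have "infinite (- B)" "infinite (- f ` B)"
    using assms by (auto simp: Compl_eq_Diff_UNIV)
  then have "bij_betw (from_nat_into (- f ` B) \<circ> to_nat_on (- B)) (- B) (- f ` B)"
    by (intro bij_betw_trans[OF to_nat_on_infinite bij_betw_from_nat_into]) auto
  then have "bij_betw (\<lambda>x. if x \<in> B then f x else (from_nat_into (- f ` B) \<circ> to_nat_on (- B)) x)
      (B \<union> - B) (f ` B \<union> - f ` B)"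
    using B by (intro bij_betw_disjoint_Un) (auto simp: bij_betw_def o_def)
  then show thesis
    by (intro that[of "\<lambda>x. if x \<in> B then f x else (from_nat_into (- f ` B) \<circ> to_nat_on (- B)) x"]) auto
qed

text \<open>
  This is what makes solvability of a system dense. The identity of \<open>g\<close> and the elements that occur in
  its tables on \<open>A\<close> form a finite set \<open>B\<close>; numbering \<open>(x, e)\<close> by \<open>x\<close> for \<open>x \<in> B\<close> and the rest of the product
  arbitrarily reproduces these tables.
\<close>

lemma enumerate_product:
  assumes g: "g \<in> enumerated_groups" and h: "h \<in> enumerated_groups" and A: "finite A"
  obtains t p q where "t \<in> enumerated_groups"
    "direct_decomposition (to_group t) (to_group g) (to_group h) p q"
    "\<And>x y. x \<in> A \<Longrightarrow> y \<in> A \<Longrightarrow> fst t (x, y) = fst g (x, y)"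
    "\<And>x. x \<in> A \<Longrightarrow> fst (snd t) x = fst (snd g) x"
    "snd (snd t) = snd (snd g)"
proof -
  let ?G = "to_group g" and ?H = "to_group h"
  interpret G: group ?G using g by (simp add: enumerated_groups_def)
  interpret H: group ?H using h by (simp add: enumerated_groups_def)
  define D where "D = ?G \<times>\<times> ?H"
  interpret D: group D unfolding D_def by (intro DirProd_group G.group_axioms H.group_axioms)
  have D: "carrier D = UNIV" "\<one>\<^bsub>D\<^esub> = (snd (snd g), snd (snd h))"
    "\<And>x y. x \<otimes>\<^bsub>D\<^esub> y = (fst g (fst x, fst y), fst h (snd x, snd y))"
    "\<And>x. inv\<^bsub>D\<^esub> x = (inv\<^bsub>?G\<^esub> (fst x), inv\<^bsub>?H\<^esub> (snd x))"
    using inv_DirProd[OF G.group_axioms H.group_axioms]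
    by (auto simp: D_def mult_DirProd' split_beta)
  define B where "B = A \<union> fst g ` (A \<times> A) \<union> fst (snd g) ` A \<union> {snd (snd g)}"
  obtain e :: "nat \<Rightarrow> nat \<times> nat" where e: "bij e"
    and eB: "\<And>x. x \<in> B \<Longrightarrow> e x = (x, snd (snd h))"
    by (rule finite_inj_extends_to_bij[of B "\<lambda>x. (x, snd (snd h))"])
      (use A in \<open>auto simp: B_def inj_on_def finite_prod\<close>)
  define d where "d = inv_into UNIV e"
  have ed [simp]: "e (d z) = z" for z
    using e by (simp add: d_def bij_is_surj surj_f_inv_f)
  have de [simp]: "d (e x) = x" for x
    using e by (simp add: d_def bij_is_inj)
  have dB: "d (x, snd (snd h)) = x" if "x \<in> B" for x
    using eB[OF that] de[of x] by simp
  define t :: enum_structure where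
    "t = ((\<lambda>(x, y). d (e x \<otimes>\<^bsub>D\<^esub> e y)), (\<lambda>x. d (inv\<^bsub>D\<^esub> e x)), d \<one>\<^bsub>D\<^esub>)"
  have t: "group (to_group t)"
  proof (rule groupI)
    fix x show "\<exists>y\<in>carrier (to_group t). y \<otimes>\<^bsub>to_group t\<^esub> x = \<one>\<^bsub>to_group t\<^esub>"
      by (rule bexI[of _ "d (inv\<^bsub>D\<^esub> e x)"]) (auto simp: t_def D(1))
  qed (auto simp: t_def D.m_assoc D(1))
  have inv_t: "inv\<^bsub>to_group t\<^esub> x = d (inv\<^bsub>D\<^esub> e x)" for x
    by (rule group.inv_equality[OF t]) (auto simp: t_def D(1))
  show thesis
  proof (rule that[of t "fst \<circ> e" "snd \<circ> e"])
    show "t \<in> enumerated_groups"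
      using t by (simp add: enumerated_groups_def inv_t) (simp add: t_def)
    have "bij_betw (\<lambda>x. ((fst \<circ> e) x, (snd \<circ> e) x)) (carrier (to_group t))
        (carrier ?G \<times> carrier ?H)"
      using e by simp
    then show "direct_decomposition (to_group t) ?G ?H (fst \<circ> e) (snd \<circ> e)"
      using t G.group_axioms H.group_axioms
      by (auto simp: direct_decomposition_def direct_decomposition_axioms_def hom_def)
        (simp_all add: t_def D)
    show "fst t (x, y) = fst g (x, y)" if "x \<in> A" "y \<in> A" for x y
      using that H.r_one[of "snd (snd h)"] by (auto simp: t_def D eB dB B_def)
    show "fst (snd t) x = fst (snd g) x" if "x \<in> A" for x
      using that H.inv_one g by (auto simp: t_def D eB dB B_def enumerated_groups_def)
    show "snd (snd t) = snd (snd g)"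
      by (auto simp: t_def D dB B_def)
  qed
qed

lemma (in direct_decomposition) solvable_in_product:
  assumes "solvable_in E I H"
  shows "solvable_in E I K"
proof -
  obtain k where k: "\<And>x. k x \<in> carrier H" "\<forall>(x, y, z)\<in>E. k x \<otimes>\<^bsub>H\<^esub> k y = k z"
    "\<And>x. x \<in> I \<Longrightarrow> k x \<noteq> \<one>\<^bsub>H\<^esub>"
    using assms by (auto simp: solvable_in_def)
  have "\<exists>y\<in>carrier K. p y = \<one>\<^bsub>G\<^esub> \<and> q y = k x" for x
    using obtain_element[OF G.one_closed k(1)] by metis
  then obtain l where l: "\<And>x. l x \<in> carrier K" "\<And>x. p (l x) = \<one>\<^bsub>G\<^esub>" "\<And>x. q (l x) = k x"
    by metis
  show ?thesis
    unfolding solvable_in_def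
  proof (intro exI[of _ l] conjI allI ballI)
    fix x assume "x \<in> E"
    then show "case x of (x, y, z) \<Rightarrow> l x \<otimes>\<^bsub>K\<^esub> l y = l z"
      using k l by (auto intro!: eqI)
  next
    fix x assume "x \<in> I"
    then show "l x \<noteq> \<one>\<^bsub>K\<^esub>" using k(3) l(3) q.hom_one by metis
  qed (rule l)
qed

section \<open>Properties closed under direct products\<close>

subsection \<open>Orderability\<close>

context direct_decomposition
begin

definition lex_order :: "('b \<times> 'b) set \<Rightarrow> ('c \<times> 'c) set \<Rightarrow> ('a \<times> 'a) set" where
  "lex_order r s = {(x, y) \<in> carrier K \<times> carrier K.
     p x \<noteq> p y \<and> (p x, p y) \<in> r \<or> p x = p y \<and> (q x, q y) \<in> s}"

lemma mem_lex_order_iff: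
  "(x, y) \<in> lex_order r s \<longleftrightarrow> x \<in> carrier K \<and> y \<in> carrier K \<and>
    (p x \<noteq> p y \<and> (p x, p y) \<in> r \<or> p x = p y \<and> (q x, q y) \<in> s)"
  by (simp add: lex_order_def)

lemma linear_order_lex_order:
  assumes r: "linear_order_on (carrier G) r" and s: "linear_order_on (carrier H) s"
  shows "linear_order_on (carrier K) (lex_order r s)"
proof -
  have r': "trans r" "antisym r" "total_on (carrier G) r"
    and s': "trans s" "antisym s" "total_on (carrier H) s" "refl_on (carrier H) s"
    using r s by (auto simp: order_on_defs)
  have "trans (lex_order r s)"
  proof (rule transI)
    fix x y z assume "(x, y) \<in> lex_order r s" "(y, z) \<in> lex_order r s"
    then show "(x, z) \<in> lex_order r s"
      using transD[OF r'(1)] transD[OF s'(1)] antisymD[OF r'(2)]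
      unfolding mem_lex_order_iff by metis
  qed
  moreover have "antisym (lex_order r s)"
  proof (rule antisymI)
    fix x y assume "(x, y) \<in> lex_order r s" "(y, x) \<in> lex_order r s"
    then show "x = y"
      using antisymD[OF r'(2)] antisymD[OF s'(2)] eqI
      unfolding mem_lex_order_iff by metis
  qed
  moreover have "total_on (carrier K) (lex_order r s)"
  proof (rule total_onI)
    fix x y assume "x \<in> carrier K" "y \<in> carrier K" "x \<noteq> y"
    then show "(x, y) \<in> lex_order r s \<or> (y, x) \<in> lex_order r s"
      using r'(3) s'(3) eqI[of x y] p.hom_closed q.hom_closed
      unfolding mem_lex_order_iff total_on_def by metis
  qed
  moreover have "refl_on (carrier K) (lex_order r s)"
    using s'(4) by (simp add: refl_on_def lex_order_def)
  moreover have "lex_order r s \<subseteq> carrier K \<times> carrier K"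
    by (auto simp: lex_order_def)
  ultimately show ?thesis
    unfolding order_on_defs by (intro conjI)
qed

lemma left_invariant_lex_order:
  assumes "left_invariant G r" "left_invariant H s"
  shows "left_invariant K (lex_order r s)"
  unfolding left_invariant_def
proof (intro ballI, clarify)
  fix k x y assume k: "k \<in> carrier K" and xy: "(x, y) \<in> lex_order r s"
  have "(p k, p x, p y) \<in> carrier G \<times> r \<Longrightarrow> (p (k \<otimes>\<^bsub>K\<^esub> x), p (k \<otimes>\<^bsub>K\<^esub> y)) \<in> r"
    "(q k, q x, q y) \<in> carrier H \<times> s \<Longrightarrow> (q (k \<otimes>\<^bsub>K\<^esub> x), q (k \<otimes>\<^bsub>K\<^esub> y)) \<in> s"
    using assms k xy by (auto simp: left_invariant_def lex_order_def)
  then show "(k \<otimes>\<^bsub>K\<^esub> x, k \<otimes>\<^bsub>K\<^esub> y) \<in> lex_order r s"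
    using k xy by (auto simp: lex_order_def)
qed

lemma right_invariant_lex_order:
  assumes "right_invariant G r" "right_invariant H s"
  shows "right_invariant K (lex_order r s)"
  unfolding right_invariant_def
proof (intro ballI, clarify)
  fix k x y assume k: "k \<in> carrier K" and xy: "(x, y) \<in> lex_order r s"
  have "(p k, p x, p y) \<in> carrier G \<times> r \<Longrightarrow> (p (x \<otimes>\<^bsub>K\<^esub> k), p (y \<otimes>\<^bsub>K\<^esub> k)) \<in> r"
    "(q k, q x, q y) \<in> carrier H \<times> s \<Longrightarrow> (q (x \<otimes>\<^bsub>K\<^esub> k), q (y \<otimes>\<^bsub>K\<^esub> k)) \<in> s"
    using assms k xy by (auto simp: right_invariant_def lex_order_def)
  then show "(x \<otimes>\<^bsub>K\<^esub> k, y \<otimes>\<^bsub>K\<^esub> k) \<in> lex_order r s"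
    using k xy by (auto simp: lex_order_def)
qed

lemma left_orderable_product: "left_orderable G \<Longrightarrow> left_orderable H \<Longrightarrow> left_orderable K"
  unfolding left_orderable_def by (blast intro: linear_order_lex_order left_invariant_lex_order)

lemma biorderable_product: "biorderable G \<Longrightarrow> biorderable H \<Longrightarrow> biorderable K"
  unfolding biorderable_def
  by (blast intro: linear_order_lex_order left_invariant_lex_order right_invariant_lex_order)

end

subsection \<open>Local indicability\<close>

text \<open>
  Having an infinite cyclic quotient is restated as having a homomorphism onto the integers, since
  these can be composed.
\<close>

lemma (in group) infinite_cyclic_quotient_iff:
  "(\<exists>N. N \<lhd> G \<and> G Mod N \<cong> integer_group) \<longleftrightarrow>
   (\<exists>f \<in> hom G integer_group. f ` carrier G = UNIV)"
proof
  assume "\<exists>N. N \<lhd> G \<and> G Mod N \<cong> integer_group"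
  then obtain N i where N: "N \<lhd> G" and i: "i \<in> iso (G Mod N) integer_group"
    by (auto simp: is_iso_def)
  have "i \<circ> (\<lambda>x. N #> x) \<in> hom G integer_group"
    using normal.r_coset_hom_Mod[OF N] i by (intro Group.hom_compose[of _ _ "G Mod N"]) (simp_all add: iso_def)
  moreover have "(\<lambda>x. N #> x) ` carrier G = carrier (G Mod N)"
    by (auto simp: FactGroup_def RCOSETS_def)
  then have "(i \<circ> (\<lambda>x. N #> x)) ` carrier G = UNIV"
    using i unfolding image_comp[symmetric] by (simp add: iso_def bij_betw_def)
  ultimately show "\<exists>f \<in> hom G integer_group. f ` carrier G = UNIV" by blast
next
  assume "\<exists>f \<in> hom G integer_group. f ` carrier G = UNIV"
  then obtain f where f: "f \<in> hom G integer_group" "f ` carrier G = UNIV" by blast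
  interpret f: group_hom G integer_group f
    using f(1) by (simp add: group_hom_def group_hom_axioms_def is_group)
  show "\<exists>N. N \<lhd> G \<and> G Mod N \<cong> integer_group"
    using f.normal_kernel f.FactGroup_iso f(2) by auto
qed

text \<open>
  The image of a finitely generated subgroup is finitely generated. If it is nontrivial, it maps
  onto the integers, and so does the subgroup by composition.
\<close>

lemma (in group_hom) locally_indicable_pullback:
  assumes H: "locally_indicable H" and X: "finite X" "X \<subseteq> carrier G"
    and nontriv: "h ` generate G X \<noteq> {\<one>\<^bsub>H\<^esub>}"
  shows "\<exists>N. N \<lhd> G\<lparr>carrier := generate G X\<rparr> \<and>
    G\<lparr>carrier := generate G X\<rparr> Mod N \<cong> integer_group"
proof -
  let ?L = "G\<lparr>carrier := generate G X\<rparr>" and ?M = "H\<lparr>carrier := generate H (h ` X)\<rparr>"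
  interpret L: group ?L
    by (intro G.subgroup_imp_group G.generate_is_subgroup X)
  have hX: "h ` X \<subseteq> carrier H" using X by auto
  interpret M: group ?M
    by (intro H.subgroup_imp_group H.generate_is_subgroup hX)
  have img: "generate H (h ` X) = h ` generate G X"
    by (rule generate_img[OF X(2)])
  have "\<exists>N. N \<lhd> ?M \<and> ?M Mod N \<cong> integer_group"
    using H X(1) hX nontriv unfolding locally_indicable_def img[symmetric] by blast
  then obtain f where f: "f \<in> hom ?M integer_group" "f ` h ` generate G X = UNIV"
    unfolding M.infinite_cyclic_quotient_iff by (auto simp: img)
  have "h \<in> hom ?L ?M"
    using G.generate_incl[OF X(2)] by (auto simp: hom_def img subset_iff)
  then have "f \<circ> h \<in> hom ?L integer_group"
    using f(1) by (rule Group.hom_compose)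
  moreover have "(f \<circ> h) ` carrier ?L = UNIV"
    using f(2) by (simp add: image_comp)
  ultimately show ?thesis
    unfolding L.infinite_cyclic_quotient_iff by blast
qed

text \<open>
  A nontrivial subgroup has a nontrivial image under one of the two projections, along which
  infinite cyclic quotients pull back.
\<close>

lemma (in direct_decomposition) locally_indicable_product:
  assumes "locally_indicable G" "locally_indicable H"
  shows "locally_indicable K"
  unfolding locally_indicable_def
proof (intro allI impI)
  fix X assume X: "finite X" "X \<subseteq> carrier K" and nontriv: "generate K X \<noteq> {\<one>\<^bsub>K\<^esub>}"
  have sub: "generate K X \<subseteq> carrier K" and one: "\<one>\<^bsub>K\<^esub> \<in> generate K X"
    using K.generate_incl[OF X(2)] generate.one by auto
  then obtain x where x: "x \<in> generate K X" "x \<noteq> \<one>\<^bsub>K\<^esub>"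
    using nontriv by blast
  then have "p x \<noteq> \<one>\<^bsub>G\<^esub> \<or> q x \<noteq> \<one>\<^bsub>H\<^esub>"
    using eqI[of x "\<one>\<^bsub>K\<^esub>"] sub by auto
  then have "p ` generate K X \<noteq> {\<one>\<^bsub>G\<^esub>} \<or> q ` generate K X \<noteq> {\<one>\<^bsub>H\<^esub>}"
    using x by blast
  then show "\<exists>N. N \<lhd> K\<lparr>carrier := generate K X\<rparr> \<and>
      K\<lparr>carrier := generate K X\<rparr> Mod N \<cong> integer_group"
    using p.locally_indicable_pullback[OF assms(1) X] q.locally_indicable_pullback[OF assms(2) X]
    by blast
qed

subsection \<open>Unique products and torsion\<close>

lemma unique_productE:
  assumes "unique_product G" and "finite X" "X \<noteq> {}" "X \<subseteq> carrier G"
    and "finite Y" "Y \<noteq> {}" "Y \<subseteq> carrier G"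
  obtains x y where "x \<in> X" "y \<in> Y"
    "\<And>a b. a \<in> X \<Longrightarrow> b \<in> Y \<Longrightarrow> x \<otimes>\<^bsub>G\<^esub> y = a \<otimes>\<^bsub>G\<^esub> b \<Longrightarrow> a = x \<and> b = y"
proof -
  obtain z where "\<exists>!c. c \<in> X \<times> Y \<and> z = fst c \<otimes>\<^bsub>G\<^esub> snd c"
    using assms(1)[unfolded unique_product_def, rule_format, OF assms(2-7)] by (rule exE)
  then obtain c where c: "c \<in> X \<times> Y" "z = fst c \<otimes>\<^bsub>G\<^esub> snd c"
    and unique: "\<And>d. d \<in> X \<times> Y \<Longrightarrow> z = fst d \<otimes>\<^bsub>G\<^esub> snd d \<Longrightarrow> d = c"
    unfolding Ex1_def by blast
  obtain x y where xy: "c = (x, y)" by (rule prod.exhaust)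
  show thesis
  proof (rule that)
    show "x \<in> X" "y \<in> Y" using c(1) xy by blast+
    fix a b assume "a \<in> X" "b \<in> Y" and eq: "x \<otimes>\<^bsub>G\<^esub> y = a \<otimes>\<^bsub>G\<^esub> b"
    then have "(a, b) \<in> X \<times> Y" by blast
    moreover have "z = fst (a, b) \<otimes>\<^bsub>G\<^esub> snd (a, b)"
      unfolding c(2) xy fst_conv snd_conv by (rule eq)
    ultimately have "(a, b) = c" by (rule unique)
    then show "a = x \<and> b = y" unfolding xy by (rule Pair_inject) (rule conjI)
  qed
qed

text \<open>
  Unique products are found one coordinate at a time: take a uniquely represented product of the
  first coordinates, and then, among the elements of \<open>X\<close> and \<open>Y\<close> with these first coordinates, a
  uniquely represented product of the second coordinates.
\<close>

lemma (in direct_decomposition) unique_product_product: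
  assumes G: "unique_product G" and H: "unique_product H"
  shows "unique_product K"
  unfolding unique_product_def
proof (intro allI impI)
  fix X Y
  assume X: "finite X" "X \<noteq> {}" "X \<subseteq> carrier K" and Y: "finite Y" "Y \<noteq> {}" "Y \<subseteq> carrier K"
  have "finite (p ` X)" "p ` X \<noteq> {}" "p ` X \<subseteq> carrier G"
       "finite (p ` Y)" "p ` Y \<noteq> {}" "p ` Y \<subseteq> carrier G"
    using X Y by auto
  with G obtain g g' where g: "g \<in> p ` X" "g' \<in> p ` Y"
    and g_unique: "\<And>c c'. c \<in> p ` X \<Longrightarrow> c' \<in> p ` Y \<Longrightarrow> g \<otimes>\<^bsub>G\<^esub> g' = c \<otimes>\<^bsub>G\<^esub> c' \<Longrightarrow> c = g \<and> c' = g'"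
    by (rule unique_productE) blast
  define X' where "X' = {x \<in> X. p x = g}"
  define Y' where "Y' = {y \<in> Y. p y = g'}"
  have "finite (q ` X')" "q ` X' \<noteq> {}" "q ` X' \<subseteq> carrier H"
       "finite (q ` Y')" "q ` Y' \<noteq> {}" "q ` Y' \<subseteq> carrier H"
    using X Y g by (auto simp: X'_def Y'_def)
  with H obtain h h' where h: "h \<in> q ` X'" "h' \<in> q ` Y'"
    and h_unique: "\<And>c c'. c \<in> q ` X' \<Longrightarrow> c' \<in> q ` Y' \<Longrightarrow> h \<otimes>\<^bsub>H\<^esub> h' = c \<otimes>\<^bsub>H\<^esub> c' \<Longrightarrow> c = h \<and> c' = h'"
    by (rule unique_productE) blast
  obtain x y where xy: "x \<in> X'" "y \<in> Y'" "q x = h" "q y = h'"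
    using h by auto
  have xyK: "x \<in> carrier K" "y \<in> carrier K" "x \<in> X" "y \<in> Y" "p x = g" "p y = g'"
    using xy X Y by (auto simp: X'_def Y'_def)
  have unique: "a = x \<and> b = y" if ab: "a \<in> X" "b \<in> Y" "x \<otimes>\<^bsub>K\<^esub> y = a \<otimes>\<^bsub>K\<^esub> b" for a b
  proof -
    have abK: "a \<in> carrier K" "b \<in> carrier K" using ab X Y by auto
    have "p x \<otimes>\<^bsub>G\<^esub> p y = p a \<otimes>\<^bsub>G\<^esub> p b" and q: "q x \<otimes>\<^bsub>H\<^esub> q y = q a \<otimes>\<^bsub>H\<^esub> q b"
      using arg_cong[OF ab(3), of p] arg_cong[OF ab(3), of q] abK xyK by simp_all
    then have p: "p a = g" "p b = g'"
      using g_unique[of "p a" "p b"] ab xyK by blast+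
    then have "q a = q x \<and> q b = q y"
      using h_unique[of "q a" "q b"] q ab xy by (simp add: X'_def Y'_def)
    then show ?thesis
      using p xyK abK eqI[of a x] eqI[of b y] by simp
  qed
  show "\<exists>z. \<exists>!c. c \<in> X \<times> Y \<and> z = fst c \<otimes>\<^bsub>K\<^esub> snd c"
  proof (intro exI ex1I)
    show "(x, y) \<in> X \<times> Y \<and> x \<otimes>\<^bsub>K\<^esub> y = fst (x, y) \<otimes>\<^bsub>K\<^esub> snd (x, y)"
      using xyK by simp
  next
    fix c assume "c \<in> X \<times> Y \<and> x \<otimes>\<^bsub>K\<^esub> y = fst c \<otimes>\<^bsub>K\<^esub> snd c"
    then show "c = (x, y)" using unique[of "fst c" "snd c"] by (cases c) auto
  qed
qed

lemma (in direct_decomposition) torsion_free_product: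
  assumes "torsion_free G" "torsion_free H"
  shows "torsion_free K"
  unfolding torsion_free_def
proof (intro ballI allI impI notI)
  fix x and n :: nat
  assume x: "x \<in> carrier K" "x \<noteq> \<one>\<^bsub>K\<^esub>" and n: "n > 0" and pow: "x [^]\<^bsub>K\<^esub> n = \<one>\<^bsub>K\<^esub>"
  have "p x [^]\<^bsub>G\<^esub> n = \<one>\<^bsub>G\<^esub>" "q x [^]\<^bsub>H\<^esub> n = \<one>\<^bsub>H\<^esub>"
    using x pow by (simp_all flip: p.hom_nat_pow q.hom_nat_pow)
  then have "p x = \<one>\<^bsub>G\<^esub>" "q x = \<one>\<^bsub>H\<^esub>"
    using assms x n by (auto simp: torsion_free_def)
  then show False using x eqI[of x "\<one>\<^bsub>K\<^esub>"] by simp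
qed

subsection \<open>Laws\<close>

lemma (in group) word_eval_closed:
  "(\<And>x. a x \<in> carrier G) \<Longrightarrow> word_eval G a w \<in> carrier G"
  by (induction w) (auto simp: word_eval_def)

lemma (in group_hom) hom_word_eval:
  assumes a: "\<And>x. a x \<in> carrier G"
  shows "h (word_eval G a w) = word_eval H (\<lambda>x. h (a x)) w"
proof (induction w)
  case (Cons l w)
  then show ?case
    using G.word_eval_closed[of a w] a by (auto simp: word_eval_def split_beta)
qed (simp add: word_eval_def)

text \<open>
  A violation of a law in \<open>G\<close> lifts along the surjective projection \<open>p\<close>.
\<close>

lemma (in direct_decomposition) satisfies_no_law_product:
  assumes "satisfies_no_law G"
  shows "satisfies_no_law K"
  unfolding satisfies_no_law_def
proof (intro allI impI)
  fix w :: "nat word" assume "freely_reduced w" "w \<noteq> []"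
  then obtain a where a: "\<And>x. a x \<in> carrier G" "word_eval G a w \<noteq> \<one>\<^bsub>G\<^esub>"
    using assms unfolding satisfies_no_law_def by blast
  have "\<exists>y\<in>carrier K. p y = a x" for x
    using obtain_element[OF a(1) H.one_closed] by metis
  then obtain b where b: "\<And>x. b x \<in> carrier K" "\<And>x. p (b x) = a x"
    by metis
  have "p (word_eval K b w) = word_eval G a w"
    using p.hom_word_eval[of b w] b by simp
  then have "word_eval K b w \<noteq> \<one>\<^bsub>K\<^esub>" using a(2) by auto
  then show "\<exists>b \<in> UNIV \<rightarrow> carrier K. word_eval K b w \<noteq> \<one>\<^bsub>K\<^esub>"
    using b by auto
qed

subsection \<open>Free subgroups\<close>

lemma (in group) no_free_subgroup_iff: "no_free_subgroup G \<longleftrightarrow> mon free_group_2 G = {}"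
proof -
  have "(\<exists>K. subgroup K G \<and> free_group_2 \<cong> G\<lparr>carrier := K\<rparr>) \<longleftrightarrow> (\<exists>f. f \<in> mon free_group_2 G)"
  proof
    assume "\<exists>K. subgroup K G \<and> free_group_2 \<cong> G\<lparr>carrier := K\<rparr>"
    then obtain K f where "subgroup K G" "f \<in> iso free_group_2 (G\<lparr>carrier := K\<rparr>)"
      by (auto simp: is_iso_def)
    then have "f \<in> mon free_group_2 G"
      by (auto simp: mon_def iso_def hom_def bij_betw_def Pi_def dest: subgroup.mem_carrier)
    then show "\<exists>f. f \<in> mon free_group_2 G" by blast
  next
    assume "\<exists>f. f \<in> mon free_group_2 G"
    then obtain f where f: "f \<in> hom free_group_2 G" "inj_on f (carrier free_group_2)"
      by (auto simp: mon_def)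
    interpret f: group_hom free_group_2 G f
      using f(1) group_free_group by (simp add: group_hom_def group_hom_axioms_def is_group)
    have "f \<in> iso free_group_2 (G\<lparr>carrier := f ` carrier free_group_2\<rparr>)"
      using f by (auto simp: iso_def hom_def bij_betw_def)
    then show "\<exists>K. subgroup K G \<and> free_group_2 \<cong> G\<lparr>carrier := K\<rparr>"
      using f.img_is_subgroup by (auto simp: is_iso_def)
  qed
  then show ?thesis by (auto simp: no_free_subgroup_def)
qed

lemma freely_reduced_append:
  "freely_reduced (u @ v) \<longleftrightarrow> freely_reduced u \<and> freely_reduced v \<and>
    (u \<noteq> [] \<longrightarrow> v \<noteq> [] \<longrightarrow> hd v \<noteq> inv_letter (last u))"
  by (auto simp: freely_reduced_def successively_append_iff)

lemma free_group_mult_append: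
  assumes "freely_reduced (u @ v)"
  shows "u \<otimes>\<^bsub>free_group\<^esub> v = u @ v"
proof -
  have "foldr red_cons u v = u @ v"
    using assms
  proof (induction u)
    case (Cons l u)
    then show ?case by (cases "u @ v") (auto simp: freely_reduced_Cons)
  qed simp
  then show ?thesis by (simp add: free_group_def)
qed

lemma free_group_simps [simp]:
  "w \<in> carrier free_group \<longleftrightarrow> freely_reduced w" "\<one>\<^bsub>free_group\<^esub> = []"
  by (simp_all add: free_group_def)

lemma inv_letter_flip: "inv_letter l = l' \<longleftrightarrow> l = inv_letter l'"
  by (auto simp: inv_letter_def)

lemma freely_reduced_rev_inv:
  "freely_reduced w \<Longrightarrow> freely_reduced (rev (map inv_letter w))"
proof (induction w)
  case (Cons l w)
  then show ?case
    by (cases w) (auto simp: freely_reduced_append freely_reduced_Cons inv_letter_flip)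
qed simp

lemma free_group_inv:
  assumes "freely_reduced w"
  shows "inv\<^bsub>free_group\<^esub> w = rev (map inv_letter w)"
proof -
  interpret group "free_group :: 'a word monoid" by (rule group_free_group)
  have "foldr red_cons (rev (map inv_letter u)) u = []" if "freely_reduced u" for u :: "'a word"
    using that
  proof (induction u)
    case (Cons l u)
    then have "red_cons (inv_letter l) (l # u) = u" by (simp add: inv_letter_flip)
    then show ?case using Cons by (simp add: freely_reduced_Cons)
  qed simp
  then have "rev (map inv_letter w) \<otimes>\<^bsub>free_group\<^esub> w = \<one>\<^bsub>free_group\<^esub>"
    using assms by (simp add: free_group_def)
  then show ?thesis
    using assms by (intro inv_equality) (auto simp: freely_reduced_rev_inv)
qed

text \<open>
  Conjugating \<open>u\<close> by \<open>l\<close> gives a reduced word of the desired shape \<open>l \<dots> l\<inverse>\<close> unless \<open>u\<close> starts with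
  \<open>l\<inverse>\<close> or ends with \<open>l\<close>. In that case at most one of the two letters over the other generator
  cancels against an end of \<open>u\<close>, so one of them can be inserted between \<open>l\<close> and \<open>u\<close>.
\<close>

lemma free_group_conjugate_framed:
  fixes u :: "bool word"
  assumes u: "freely_reduced u" "u \<noteq> []"
  obtains c m where "freely_reduced c" "freely_reduced (l # m @ [inv_letter l])"
    "c \<otimes>\<^bsub>free_group\<^esub> u \<otimes>\<^bsub>free_group\<^esub> inv\<^bsub>free_group\<^esub> c = l # m @ [inv_letter l]"
proof -
  interpret F: group "free_group :: bool word monoid" by (rule group_free_group)
  obtain c where c: "freely_reduced (l # c)" "freely_reduced ((l # c) @ u)"
    "freely_reduced (u @ rev (map inv_letter (l # c)))"
  proof (cases "freely_reduced (l # u) \<and> freely_reduced (u @ [inv_letter l])")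
    case True
    then show thesis using that[of "[]"] by (simp add: freely_reduced_Cons)
  next
    case False
    define l' where "l' b = (\<not> fst l, b)" for b :: bool
    have "\<exists>b. freely_reduced (l' b # u) \<and> freely_reduced (u @ [inv_letter (l' b)])"
    proof (rule ccontr)
      assume "\<not> ?thesis"
      then have "hd u = inv_letter (l' b) \<or> last u = l' b" for b
        using u by (auto simp: freely_reduced_append freely_reduced_Cons inv_letter_flip)
      from this[of True] this[of False]
      have "last u \<noteq> l \<and> hd u \<noteq> inv_letter l"
        by (auto simp: inv_letter_def l'_def prod_eq_iff)
      with False u show False
        by (auto simp: freely_reduced_append freely_reduced_Cons inv_letter_flip)
    qed
    then obtain b where "freely_reduced (l' b # u)" "freely_reduced (u @ [inv_letter (l' b)])" by blast
    then show thesis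
      using u by (intro that[of "[l' b]"])
        (auto simp: freely_reduced_append freely_reduced_Cons inv_letter_def l'_def prod_eq_iff)
  qed
  let ?i = "rev (map inv_letter (l # c))"
  have red: "freely_reduced ((l # c) @ u @ ?i)"
    unfolding freely_reduced_append[of "l # c" "u @ ?i"]
    using c u freely_reduced_append[of "l # c" u] by simp
  then have "(l # c) \<otimes>\<^bsub>free_group\<^esub> u \<otimes>\<^bsub>free_group\<^esub> inv\<^bsub>free_group\<^esub> (l # c) = (l # c) @ u @ ?i"
    using c by (simp add: free_group_inv free_group_mult_append)
  then show thesis
    using c red by (intro that[of "l # c" "c @ u @ rev (map inv_letter c)"]) simp_all
qed

text \<open>
  If the conjugates are framed by \<open>a, a\<inverse>\<close> and by \<open>b, b\<inverse>\<close> for the two generators \<open>a\<close> and \<open>b\<close>, then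
  neither of the two products cancels. One of them starts with \<open>a\<close>, the other with \<open>b\<close>.
\<close>

lemma free_group_conjugates_not_commuting:
  fixes u v :: "bool word"
  assumes u: "freely_reduced u" "u \<noteq> []" and v: "freely_reduced v" "v \<noteq> []"
  obtains c d where "freely_reduced c" "freely_reduced d"
    "(c \<otimes>\<^bsub>free_group\<^esub> u \<otimes>\<^bsub>free_group\<^esub> inv\<^bsub>free_group\<^esub> c) \<otimes>\<^bsub>free_group\<^esub> (d \<otimes>\<^bsub>free_group\<^esub> v \<otimes>\<^bsub>free_group\<^esub> inv\<^bsub>free_group\<^esub> d) \<noteq>
     (d \<otimes>\<^bsub>free_group\<^esub> v \<otimes>\<^bsub>free_group\<^esub> inv\<^bsub>free_group\<^esub> d) \<otimes>\<^bsub>free_group\<^esub> (c \<otimes>\<^bsub>free_group\<^esub> u \<otimes>\<^bsub>free_group\<^esub> inv\<^bsub>free_group\<^esub> c)"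
proof -
  define a b :: "bool \<times> bool" where "a = (True, True)" and "b = (False, True)"
  obtain c m where c: "freely_reduced c" "freely_reduced (a # m @ [inv_letter a])"
    "c \<otimes>\<^bsub>free_group\<^esub> u \<otimes>\<^bsub>free_group\<^esub> inv\<^bsub>free_group\<^esub> c = a # m @ [inv_letter a]"
    by (rule free_group_conjugate_framed[OF u])
  obtain d n where d: "freely_reduced d" "freely_reduced (b # n @ [inv_letter b])"
    "d \<otimes>\<^bsub>free_group\<^esub> v \<otimes>\<^bsub>free_group\<^esub> inv\<^bsub>free_group\<^esub> d = b # n @ [inv_letter b]"
    by (rule free_group_conjugate_framed[OF v])
  have "freely_reduced ((a # m @ [inv_letter a]) @ (b # n @ [inv_letter b]))"
    "freely_reduced ((b # n @ [inv_letter b]) @ (a # m @ [inv_letter a]))"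
    unfolding freely_reduced_append using c(2) d(2) by (simp_all add: a_def b_def inv_letter_def)
  from this[THEN free_group_mult_append] show thesis
    by (intro that[OF c(1) d(1)]) (simp only: c(3) d(3), simp add: a_def b_def)
qed

text \<open>
  If neither projection is injective on a free subgroup, take nontrivial \<open>u\<close> in the kernel of the
  first and \<open>v\<close> in the kernel of the second. All conjugates of \<open>u\<close> commute with all conjugates of
  \<open>v\<close>, because they do so in both coordinates.
\<close>

lemma (in direct_decomposition) no_free_subgroup_product:
  assumes "no_free_subgroup G" "no_free_subgroup H"
  shows "no_free_subgroup K"
proof (rule ccontr)
  assume "\<not> no_free_subgroup K"
  then obtain f where f: "f \<in> hom free_group_2 K" "inj_on f (carrier free_group_2)"
    by (auto simp: K.no_free_subgroup_iff mon_def)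
  interpret f: group_hom free_group_2 K f
    using f(1) group_free_group by (simp add: group_hom_def group_hom_axioms_def K.is_group)
  interpret pf: group_hom free_group_2 G "p \<circ> f"
    using Group.hom_compose[OF f(1) p_hom] by unfold_locales
  interpret qf: group_hom free_group_2 H "q \<circ> f"
    using Group.hom_compose[OF f(1) q_hom] by unfold_locales
  have "\<not> inj_on (p \<circ> f) (carrier free_group_2)" "\<not> inj_on (q \<circ> f) (carrier free_group_2)"
    using assms pf.homh qf.homh unfolding G.no_free_subgroup_iff H.no_free_subgroup_iff mon_def
    by blast+
  then obtain u v where u: "freely_reduced u" "u \<noteq> []" "(p \<circ> f) u = \<one>\<^bsub>G\<^esub>"
    and v: "freely_reduced v" "v \<noteq> []" "(q \<circ> f) v = \<one>\<^bsub>H\<^esub>"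
    unfolding pf.inj_on_one_iff qf.inj_on_one_iff by auto
  obtain c d where cd: "freely_reduced c" "freely_reduced d"
    and ne: "(c \<otimes>\<^bsub>free_group\<^esub> u \<otimes>\<^bsub>free_group\<^esub> inv\<^bsub>free_group\<^esub> c) \<otimes>\<^bsub>free_group\<^esub> (d \<otimes>\<^bsub>free_group\<^esub> v \<otimes>\<^bsub>free_group\<^esub> inv\<^bsub>free_group\<^esub> d) \<noteq>
     (d \<otimes>\<^bsub>free_group\<^esub> v \<otimes>\<^bsub>free_group\<^esub> inv\<^bsub>free_group\<^esub> d) \<otimes>\<^bsub>free_group\<^esub> (c \<otimes>\<^bsub>free_group\<^esub> u \<otimes>\<^bsub>free_group\<^esub> inv\<^bsub>free_group\<^esub> c)"
    by (rule free_group_conjugates_not_commuting[OF u(1,2) v(1,2)])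
  define u' where "u' = c \<otimes>\<^bsub>free_group\<^esub> u \<otimes>\<^bsub>free_group\<^esub> inv\<^bsub>free_group\<^esub> c"
  define v' where "v' = d \<otimes>\<^bsub>free_group\<^esub> v \<otimes>\<^bsub>free_group\<^esub> inv\<^bsub>free_group\<^esub> d"
  have uv: "u' \<in> carrier free_group_2" "v' \<in> carrier free_group_2"
    using u v cd unfolding u'_def v'_def
    by (auto intro!: f.G.m_closed f.G.inv_closed simp del: free_group_simps simp flip: free_group_simps(1))
  have "(p \<circ> f) u' = \<one>\<^bsub>G\<^esub>" "(q \<circ> f) v' = \<one>\<^bsub>H\<^esub>"
    using u v cd unfolding u'_def v'_def free_group_simps(1)[symmetric]
    by (simp_all del: free_group_simps comp_apply)
  then have "(p \<circ> f) (u' \<otimes>\<^bsub>free_group\<^esub> v') = (p \<circ> f) (v' \<otimes>\<^bsub>free_group\<^esub> u')"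
    "(q \<circ> f) (u' \<otimes>\<^bsub>free_group\<^esub> v') = (q \<circ> f) (v' \<otimes>\<^bsub>free_group\<^esub> u')"
    using uv by (simp_all del: free_group_simps comp_apply)
  then have "f (u' \<otimes>\<^bsub>free_group\<^esub> v') = f (v' \<otimes>\<^bsub>free_group\<^esub> u')"
    using uv by (intro eqI) (simp_all del: free_group_simps)
  then have "u' \<otimes>\<^bsub>free_group\<^esub> v' = v' \<otimes>\<^bsub>free_group\<^esub> u'"
    by (rule inj_onD[OF f(2)]) (use uv in \<open>auto simp del: free_group_simps\<close>)
  with ne show False by (simp add: u'_def v'_def)
qed

subsection \<open>Amenability\<close>

context
  fixes G :: "('a, 'b) monoid_scheme" and m :: "('a \<Rightarrow> real) \<Rightarrow> real"
  assumes m: "invariant_mean G m"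
begin

lemma mean_add:
  "bounded (f ` carrier G) \<Longrightarrow> bounded (g ` carrier G) \<Longrightarrow> m (\<lambda>x. f x + g x) = m f + m g"
  using m by (simp add: invariant_mean_def)

lemma mean_cmult: "bounded (f ` carrier G) \<Longrightarrow> m (\<lambda>x. c * f x) = c * m f"
  using m by (simp add: invariant_mean_def)

lemma mean_nonneg: "bounded (f ` carrier G) \<Longrightarrow> (\<And>x. x \<in> carrier G \<Longrightarrow> 0 \<le> f x) \<Longrightarrow> 0 \<le> m f"
  using m by (simp add: invariant_mean_def)

lemma mean_one: "m (\<lambda>x. 1) = 1"
  using m by (simp add: invariant_mean_def)

lemma mean_translate:
  "g \<in> carrier G \<Longrightarrow> bounded (f ` carrier G) \<Longrightarrow> m (\<lambda>x. f (g \<otimes>\<^bsub>G\<^esub> x)) = m f"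
  using m by (simp add: invariant_mean_def)

lemma mean_mono:
  assumes f: "bounded (f ` carrier G)" and g: "bounded (g ` carrier G)"
    and le: "\<And>x. x \<in> carrier G \<Longrightarrow> f x \<le> g x"
  shows "m f \<le> m g"
proof -
  have f': "bounded ((\<lambda>x. (- 1) * f x) ` carrier G)"
    using f by (auto simp: bounded_iff)
  have "m (\<lambda>x. g x + (- 1) * f x) = m g + (- 1) * m f"
    using mean_add[OF g f'] mean_cmult[OF f, of "- 1"] by simp
  moreover have "0 \<le> m (\<lambda>x. g x + (- 1) * f x)"
    using bounded_plus_comp[OF g f'] le by (intro mean_nonneg) auto
  ultimately show ?thesis by simp
qed

text \<open>
  By positivity a mean only depends on the restriction of its argument to the carrier. This is
  needed because a product element is only available for arguments from the carriers.
\<close>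

lemma mean_cong:
  assumes f: "bounded (f ` carrier G)" and eq: "\<And>x. x \<in> carrier G \<Longrightarrow> f x = g x"
  shows "m f = m g"
proof -
  have "bounded (g ` carrier G)" using f eq by (simp cong: image_cong)
  then show ?thesis
    using f eq by (intro antisym mean_mono) auto
qed

lemma mean_const: "m (\<lambda>x. c) = c"
  using mean_cmult[OF bounded_subset[of "{1}"], of "\<lambda>x. 1" c] mean_one by auto

lemma abs_mean_le:
  assumes le: "\<And>x. x \<in> carrier G \<Longrightarrow> \<bar>f x\<bar> \<le> c"
  shows "\<bar>m f\<bar> \<le> c"
proof -
  have "bounded (f ` carrier G)" using le by (auto simp: bounded_iff)
  moreover have "bounded ((\<lambda>x. d) ` carrier G)" for d :: real
    by (auto simp: bounded_iff)
  ultimately have "m f \<le> m (\<lambda>x. c)" "m (\<lambda>x. - c) \<le> m f"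
    using le by (intro mean_mono; force)+
  then show ?thesis by (simp add: mean_const)
qed

end

text \<open>
  The mean of the product averages a function over the fibres of \<open>p\<close> by the mean of \<open>H\<close> and then
  applies the mean of \<open>G\<close>. Translation by \<open>k\<close> translates each fibre by \<open>q k\<close>, which the inner mean
  ignores, and permutes the fibres by \<open>p k\<close>, which the outer mean ignores.
\<close>

lemma (in direct_decomposition) amenable_product:
  assumes "amenable G" "amenable H"
  shows "amenable K"
proof -
  obtain m n where m: "invariant_mean G m" and n: "invariant_mean H n"
    using assms by (auto simp: amenable_def)
  have "\<exists>x. x \<in> carrier K \<and> p x = g \<and> q x = h" if "g \<in> carrier G" "h \<in> carrier H" for g h
    using obtain_element[OF that] by metis
  then obtain pair where pair: "\<And>g h. g \<in> carrier G \<Longrightarrow> h \<in> carrier H \<Longrightarrow>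
      pair g h \<in> carrier K \<and> p (pair g h) = g \<and> q (pair g h) = h"
    by metis
  define avg where "avg f g = n (\<lambda>h. f (pair g h))" for f g
  have fibre: "bounded ((\<lambda>h. f (pair g h)) ` carrier H)"
    if "bounded (f ` carrier K)" "g \<in> carrier G" for f :: "'a \<Rightarrow> real" and g
    using that(1) by (rule bounded_subset) (use pair that(2) in auto)
  have avg_bounded: "bounded (avg f ` carrier G)" if f: "bounded (f ` carrier K)" for f
  proof -
    obtain c where "\<And>x. x \<in> carrier K \<Longrightarrow> \<bar>f x\<bar> \<le> c"
      using f by (auto simp: bounded_iff)
    then have "\<bar>avg f g\<bar> \<le> c" if "g \<in> carrier G" for g
      unfolding avg_def using pair that by (intro abs_mean_le[OF n]) auto
    then show ?thesis by (auto simp: bounded_iff)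
  qed
  have "invariant_mean K (\<lambda>f. m (avg f))"
    unfolding invariant_mean_def
  proof (intro conjI allI impI ballI)
    fix f g :: "'a \<Rightarrow> real"
    assume f: "bounded (f ` carrier K)" and g: "bounded (g ` carrier K)"
    have "m (avg (\<lambda>x. f x + g x)) = m (\<lambda>x. avg f x + avg g x)"
      by (rule mean_cong[OF m avg_bounded[OF bounded_plus_comp[OF f g]]])
        (simp add: avg_def mean_add[OF n] fibre f g)
    also have "\<dots> = m (avg f) + m (avg g)"
      by (intro mean_add[OF m] avg_bounded f g)
    finally show "m (avg (\<lambda>x. f x + g x)) = m (avg f) + m (avg g)" .
  next
    fix c and f :: "'a \<Rightarrow> real"
    assume f: "bounded (f ` carrier K)"
    then have cf: "bounded ((\<lambda>x. c * f x) ` carrier K)"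
      using bounded_scaling[of "f ` carrier K" c] by (simp add: image_image)
    have "m (avg (\<lambda>x. c * f x)) = m (\<lambda>x. c * avg f x)"
      by (rule mean_cong[OF m avg_bounded[OF cf]]) (simp add: avg_def mean_cmult[OF n] fibre f)
    also have "\<dots> = c * m (avg f)"
      by (intro mean_cmult[OF m] avg_bounded f)
    finally show "m (avg (\<lambda>x. c * f x)) = c * m (avg f)" .
  next
    fix f :: "'a \<Rightarrow> real"
    assume f: "bounded (f ` carrier K)" and "\<forall>x\<in>carrier K. 0 \<le> f x"
    then have "0 \<le> avg f g" if "g \<in> carrier G" for g
      unfolding avg_def using that pair by (intro mean_nonneg[OF n] fibre) auto
    then show "0 \<le> m (avg f)"
      by (intro mean_nonneg[OF m] avg_bounded f)
  next
    have "avg (\<lambda>x. 1) = (\<lambda>g. 1)"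
      by (simp add: avg_def fun_eq_iff mean_one[OF n])
    then show "m (avg (\<lambda>x. 1)) = 1"
      by (simp add: mean_one[OF m])
  next
    fix k and f :: "'a \<Rightarrow> real"
    assume k: "k \<in> carrier K" and f: "bounded (f ` carrier K)"
    have kf: "bounded ((\<lambda>x. f (k \<otimes>\<^bsub>K\<^esub> x)) ` carrier K)"
      using f by (rule bounded_subset) (use k in auto)
    have "m (avg (\<lambda>x. f (k \<otimes>\<^bsub>K\<^esub> x))) = m (\<lambda>g. avg f (p k \<otimes>\<^bsub>G\<^esub> g))"
    proof (rule mean_cong[OF m avg_bounded[OF kf]])
      fix g assume g: "g \<in> carrier G"
      have "avg (\<lambda>x. f (k \<otimes>\<^bsub>K\<^esub> x)) g = n (\<lambda>h. f (pair (p k \<otimes>\<^bsub>G\<^esub> g) (q k \<otimes>\<^bsub>H\<^esub> h)))"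
        unfolding avg_def
      proof (rule mean_cong[OF n fibre[OF kf g]])
        fix h assume h: "h \<in> carrier H"
        have "k \<otimes>\<^bsub>K\<^esub> pair g h = pair (p k \<otimes>\<^bsub>G\<^esub> g) (q k \<otimes>\<^bsub>H\<^esub> h)"
          using pair[OF g h] pair[of "p k \<otimes>\<^bsub>G\<^esub> g" "q k \<otimes>\<^bsub>H\<^esub> h"] g h k by (intro eqI) auto
        then show "f (k \<otimes>\<^bsub>K\<^esub> pair g h) = f (pair (p k \<otimes>\<^bsub>G\<^esub> g) (q k \<otimes>\<^bsub>H\<^esub> h))" by simp
      qed
      also have "\<dots> = avg f (p k \<otimes>\<^bsub>G\<^esub> g)"
        unfolding avg_def using k g by (intro mean_translate[OF n] fibre f) auto
      finally show "avg (\<lambda>x. f (k \<otimes>\<^bsub>K\<^esub> x)) g = avg f (p k \<otimes>\<^bsub>G\<^esub> g)" .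
    qed
    also have "\<dots> = m (avg f)"
      using k by (intro mean_translate[OF m] avg_bounded f) auto
    finally show "m (avg (\<lambda>x. f (k \<otimes>\<^bsub>K\<^esub> x))) = m (avg f)" .
  qed
  then show ?thesis by (auto simp: amenable_def)
qed

subsection \<open>Soficity\<close>

lemma hamming_dist_bounds: "0 \<le> hamming_dist n \<sigma> \<tau>" "hamming_dist n \<sigma> \<tau> \<le> 1"
proof -
  have "card {i \<in> {1..n}. \<sigma> i \<noteq> \<tau> i} \<le> card {1..n}"
    by (rule card_mono) auto
  then show "0 \<le> hamming_dist n \<sigma> \<tau>" "hamming_dist n \<sigma> \<tau> \<le> 1"
    by (auto simp: hamming_dist_def divide_le_eq_1)
qed

lemma one_minus_hamming_dist:
  assumes "n > 0"
  shows "1 - hamming_dist n \<sigma> \<tau> = real (card {i \<in> {1..n}. \<sigma> i = \<tau> i}) / real n"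
proof -
  have "card ({i \<in> {1..n}. \<sigma> i = \<tau> i} \<union> {i \<in> {1..n}. \<sigma> i \<noteq> \<tau> i}) =
      card {i \<in> {1..n}. \<sigma> i = \<tau> i} + card {i \<in> {1..n}. \<sigma> i \<noteq> \<tau> i}"
    by (rule card_Un_disjoint) auto
  moreover have "{i \<in> {1..n}. \<sigma> i = \<tau> i} \<union> {i \<in> {1..n}. \<sigma> i \<noteq> \<tau> i} = {1..n}" by auto
  ultimately have "real n = real (card {i \<in> {1..n}. \<sigma> i = \<tau> i}) + real (card {i \<in> {1..n}. \<sigma> i \<noteq> \<tau> i})"
    by (simp flip: of_nat_add)
  then show ?thesis
    using assms by (simp add: hamming_dist_def field_simps)
qed

text \<open>
  The permutation \<open>\<Phi> \<sigma> \<tau>\<close> is \<open>\<sigma> \<times> \<tau>\<close> on \<open>{1..n} \<times> {1..m}\<close>, transported to \<open>{1..n * m}\<close> along an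
  arbitrary bijection. Two such permutations agree exactly where both components agree, so the
  proportions of agreement multiply.
\<close>

lemma product_action:
  assumes "n > 0" "m > 0"
  obtains \<Phi> :: "(nat \<Rightarrow> nat) \<Rightarrow> (nat \<Rightarrow> nat) \<Rightarrow> nat \<Rightarrow> nat" where
    "\<And>\<sigma> \<tau>. \<sigma> permutes {1..n} \<Longrightarrow> \<tau> permutes {1..m} \<Longrightarrow> \<Phi> \<sigma> \<tau> permutes {1..n * m}"
    "\<And>\<sigma> \<tau> \<sigma>' \<tau>'. \<sigma>' permutes {1..n} \<Longrightarrow> \<tau>' permutes {1..m} \<Longrightarrow>
       \<Phi> (\<sigma> \<circ> \<sigma>') (\<tau> \<circ> \<tau>') = \<Phi> \<sigma> \<tau> \<circ> \<Phi> \<sigma>' \<tau>'"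
    "\<Phi> id id = id"
    "\<And>\<sigma> \<tau> \<sigma>' \<tau>'. \<sigma> permutes {1..n} \<Longrightarrow> \<tau> permutes {1..m} \<Longrightarrow> \<sigma>' permutes {1..n} \<Longrightarrow> \<tau>' permutes {1..m} \<Longrightarrow>
       1 - hamming_dist (n * m) (\<Phi> \<sigma> \<tau>) (\<Phi> \<sigma>' \<tau>') = (1 - hamming_dist n \<sigma> \<sigma>') * (1 - hamming_dist m \<tau> \<tau>')"
proof -
  let ?A = "{1..n} \<times> {1..m}" and ?B = "{1..n * m}"
  obtain e where e: "bij_betw e ?A ?B"
    using finite_same_card_bij[of ?A ?B] by auto
  define \<Phi> where "\<Phi> \<sigma> \<tau> = map_permutation ?A e (map_prod \<sigma> \<tau>)" for \<sigma> \<tau> :: "nat \<Rightarrow> nat"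
  have inj: "inj_on e ?A" and img: "e ` ?A = ?B"
    using e by (auto simp: bij_betw_def)
  have in_B: "e (i, j) \<in> ?B" if "i \<in> {1..n}" "j \<in> {1..m}" for i j
    using that e by (auto dest: bij_betwE)
  have from_B: "\<exists>i\<in>{1..n}. \<exists>j\<in>{1..m}. k = e (i, j)" if "k \<in> ?B" for k
    using that unfolding img[symmetric] by auto
  have \<Phi>_apply: "\<Phi> \<sigma> \<tau> (e (i, j)) = e (\<sigma> i, \<tau> j)" if "i \<in> {1..n}" "j \<in> {1..m}" for \<sigma> \<tau> i j
    using that unfolding \<Phi>_def by (subst map_permutation_apply[OF inj]) auto
  have outside: "\<Phi> \<sigma> \<tau> k = k" if "k \<notin> ?B" for \<sigma> \<tau> k
    using that unfolding \<Phi>_def map_permutation_def restrict_id_def img by auto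
  have mem: "\<sigma> i \<in> {1..n}" if "\<sigma> permutes {1..n}" "i \<in> {1..n}" for \<sigma> :: "nat \<Rightarrow> nat" and i n
    using that by (simp only: permutes_in_image)
  show thesis
  proof (rule that[of \<Phi>])
    fix \<sigma> \<tau> assume \<sigma>: "\<sigma> permutes {1..n}" and \<tau>: "\<tau> permutes {1..m}"
    show "\<Phi> \<sigma> \<tau> permutes ?B"
    proof (rule inj_imp_permutes)
      show "inj_on (\<Phi> \<sigma> \<tau>) ?B"
      proof (rule inj_onI)
        fix k l assume kl: "k \<in> ?B" "l \<in> ?B" and eq: "\<Phi> \<sigma> \<tau> k = \<Phi> \<sigma> \<tau> l"
        obtain i j i' j' where k: "k = e (i, j)" "i \<in> {1..n}" "j \<in> {1..m}"
          and l: "l = e (i', j')" "i' \<in> {1..n}" "j' \<in> {1..m}"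
          using from_B kl by metis
        have "e (\<sigma> i, \<tau> j) = e (\<sigma> i', \<tau> j')"
          using eq \<Phi>_apply k l by simp
        then have "\<sigma> i = \<sigma> i'" "\<tau> j = \<tau> j'"
          using inj_onD[OF inj, of "(\<sigma> i, \<tau> j)" "(\<sigma> i', \<tau> j')"] mem[OF \<sigma>] mem[OF \<tau>] k l by auto
        then show "k = l"
          using permutes_inj[OF \<sigma>] permutes_inj[OF \<tau>] k l by (auto dest: injD)
      qed
      fix k assume "k \<in> ?B"
      then obtain i j where "k = e (i, j)" "i \<in> {1..n}" "j \<in> {1..m}"
        using from_B by metis
      then show "\<Phi> \<sigma> \<tau> k \<in> ?B"
        using in_B[OF mem[OF \<sigma>] mem[OF \<tau>]] by (simp only: \<Phi>_apply)
    qed (auto simp: outside)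
  next
    fix \<sigma> \<tau> \<sigma>' \<tau>' assume \<sigma>': "\<sigma>' permutes {1..n}" and \<tau>': "\<tau>' permutes {1..m}"
    show "\<Phi> (\<sigma> \<circ> \<sigma>') (\<tau> \<circ> \<tau>') = \<Phi> \<sigma> \<tau> \<circ> \<Phi> \<sigma>' \<tau>'"
    proof
      fix k show "\<Phi> (\<sigma> \<circ> \<sigma>') (\<tau> \<circ> \<tau>') k = (\<Phi> \<sigma> \<tau> \<circ> \<Phi> \<sigma>' \<tau>') k"
      proof (cases "k \<in> ?B")
        case True
        then obtain i j where "k = e (i, j)" "i \<in> {1..n}" "j \<in> {1..m}"
          using from_B by metis
        then show ?thesis using mem[OF \<sigma>'] mem[OF \<tau>'] by (simp only: \<Phi>_apply comp_apply)
      qed (simp add: outside)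
    qed
  next
    show "\<Phi> id id = id"
      using inj by (simp add: \<Phi>_def map_prod.id map_permutation_id')
  next
    fix \<sigma> \<tau> \<sigma>' \<tau>'
    assume \<sigma>: "\<sigma> permutes {1..n}" "\<sigma>' permutes {1..n}" and \<tau>: "\<tau> permutes {1..m}" "\<tau>' permutes {1..m}"
    let ?S = "{i \<in> {1..n}. \<sigma> i = \<sigma>' i}" and ?T = "{j \<in> {1..m}. \<tau> j = \<tau>' j}"
    have agree: "\<Phi> \<sigma> \<tau> (e (i, j)) = \<Phi> \<sigma>' \<tau>' (e (i, j)) \<longleftrightarrow> \<sigma> i = \<sigma>' i \<and> \<tau> j = \<tau>' j"
      if "i \<in> {1..n}" "j \<in> {1..m}" for i j
      unfolding \<Phi>_apply[OF that]
      using inj_on_eq_iff[OF inj, of "(\<sigma> i, \<tau> j)" "(\<sigma>' i, \<tau>' j)"]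
        mem[OF \<sigma>(1)] mem[OF \<sigma>(2)] mem[OF \<tau>(1)] mem[OF \<tau>(2)] that by auto
    have "{k \<in> ?B. \<Phi> \<sigma> \<tau> k = \<Phi> \<sigma>' \<tau>' k} = e ` (?S \<times> ?T)"
    proof (intro equalityI subsetI)
      fix k assume "k \<in> {k \<in> ?B. \<Phi> \<sigma> \<tau> k = \<Phi> \<sigma>' \<tau>' k}"
      then obtain i j where ij: "k = e (i, j)" "i \<in> {1..n}" "j \<in> {1..m}"
        and "\<Phi> \<sigma> \<tau> k = \<Phi> \<sigma>' \<tau>' k"
        using from_B by blast
      then have "(i, j) \<in> ?S \<times> ?T" using agree by blast
      then show "k \<in> e ` (?S \<times> ?T)" unfolding ij(1) by (rule imageI)
    next
      fix k assume "k \<in> e ` (?S \<times> ?T)"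
      then show "k \<in> {k \<in> ?B. \<Phi> \<sigma> \<tau> k = \<Phi> \<sigma>' \<tau>' k}" using agree in_B by blast
    qed
    moreover have "inj_on e (?S \<times> ?T)"
      using inj by (rule inj_on_subset) auto
    ultimately have "card {k \<in> ?B. \<Phi> \<sigma> \<tau> k = \<Phi> \<sigma>' \<tau>' k} = card ?S * card ?T"
      by (simp add: card_image card_cartesian_product)
    then show "1 - hamming_dist (n * m) (\<Phi> \<sigma> \<tau>) (\<Phi> \<sigma>' \<tau>') =
        (1 - hamming_dist n \<sigma> \<sigma>') * (1 - hamming_dist m \<tau> \<tau>')"
      using assms by (simp add: one_minus_hamming_dist)
  qed
qed

text \<open>
  Let \<open>a\<close> and \<open>b\<close> be the distances in the two components. The distance \<open>1 - (1 - a) (1 - b)\<close> in the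
  product is at most \<open>a + b\<close>, which bounds the defect of multiplicativity, and at least \<open>a\<close> and \<open>b\<close>,
  so that an element moves almost all points if one of its components does.
\<close>

lemma (in direct_decomposition) sofic_product:
  assumes G: "sofic G" and H: "sofic H"
  shows "sofic K"
  unfolding sofic_def
proof (intro allI impI)
  fix F and \<epsilon> :: real
  assume F: "finite F" "F \<subseteq> carrier K" and \<epsilon>: "\<epsilon> > 0"
  have FG: "finite (p ` F)" "p ` F \<subseteq> carrier G" and FH: "finite (q ` F)" "q ` F \<subseteq> carrier H"
    and \<epsilon>2: "\<epsilon> / 2 > 0"
    using F \<epsilon> by auto
  obtain n \<phi> where n: "n > 0" and \<phi>: "\<phi> \<in> carrier G \<rightarrow> carrier (sym_group n)"
    and \<phi>_mult: "\<forall>g\<in>p ` F. \<forall>h\<in>p ` F. hamming_dist n (\<phi> (g \<otimes>\<^bsub>G\<^esub> h)) (\<phi> g \<circ> \<phi> h) < \<epsilon> / 2"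
    and \<phi>_free: "\<forall>g\<in>p ` F. g \<noteq> \<one>\<^bsub>G\<^esub> \<longrightarrow> hamming_dist n (\<phi> g) id > 1 - \<epsilon> / 2"
    using G[unfolded sofic_def, rule_format, OF FG \<epsilon>2] by blast
  obtain m \<psi> where m: "m > 0" and \<psi>: "\<psi> \<in> carrier H \<rightarrow> carrier (sym_group m)"
    and \<psi>_mult: "\<forall>g\<in>q ` F. \<forall>h\<in>q ` F. hamming_dist m (\<psi> (g \<otimes>\<^bsub>H\<^esub> h)) (\<psi> g \<circ> \<psi> h) < \<epsilon> / 2"
    and \<psi>_free: "\<forall>g\<in>q ` F. g \<noteq> \<one>\<^bsub>H\<^esub> \<longrightarrow> hamming_dist m (\<psi> g) id > 1 - \<epsilon> / 2"
    using H[unfolded sofic_def, rule_format, OF FH \<epsilon>2] by blast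
  obtain \<Phi> where \<Phi>: "\<And>\<sigma> \<tau>. \<sigma> permutes {1..n} \<Longrightarrow> \<tau> permutes {1..m} \<Longrightarrow> \<Phi> \<sigma> \<tau> permutes {1..n * m}"
    and \<Phi>_comp: "\<And>\<sigma> \<tau> \<sigma>' \<tau>'. \<sigma>' permutes {1..n} \<Longrightarrow> \<tau>' permutes {1..m} \<Longrightarrow>
       \<Phi> (\<sigma> \<circ> \<sigma>') (\<tau> \<circ> \<tau>') = \<Phi> \<sigma> \<tau> \<circ> \<Phi> \<sigma>' \<tau>'"
    and \<Phi>_id: "\<Phi> id id = id"
    and \<Phi>_dist: "\<And>\<sigma> \<tau> \<sigma>' \<tau>'. \<sigma> permutes {1..n} \<Longrightarrow> \<tau> permutes {1..m} \<Longrightarrow> \<sigma>' permutes {1..n} \<Longrightarrow> \<tau>' permutes {1..m} \<Longrightarrow>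
       1 - hamming_dist (n * m) (\<Phi> \<sigma> \<tau>) (\<Phi> \<sigma>' \<tau>') = (1 - hamming_dist n \<sigma> \<sigma>') * (1 - hamming_dist m \<tau> \<tau>')"
    using that by (rule product_action[OF n m])
  have perm: "\<phi> (p x) permutes {1..n}" "\<psi> (q x) permutes {1..m}" if "x \<in> carrier K" for x
    using \<phi> \<psi> that by (auto simp: Pi_iff sym_group_carrier)
  define \<theta> where "\<theta> x = \<Phi> (\<phi> (p x)) (\<psi> (q x))" for x
  have "hamming_dist (n * m) (\<theta> (g \<otimes>\<^bsub>K\<^esub> h)) (\<theta> g \<circ> \<theta> h) < \<epsilon>" if gh: "g \<in> F" "h \<in> F" for g h
  proof -
    have K: "g \<in> carrier K" "h \<in> carrier K" using gh F by auto
    let ?a = "hamming_dist n (\<phi> (p (g \<otimes>\<^bsub>K\<^esub> h))) (\<phi> (p g) \<circ> \<phi> (p h))"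
    let ?b = "hamming_dist m (\<psi> (q (g \<otimes>\<^bsub>K\<^esub> h))) (\<psi> (q g) \<circ> \<psi> (q h))"
    have "1 - hamming_dist (n * m) (\<theta> (g \<otimes>\<^bsub>K\<^esub> h)) (\<theta> g \<circ> \<theta> h) = (1 - ?a) * (1 - ?b)"
      unfolding \<theta>_def \<Phi>_comp[OF perm[OF K(2)], symmetric]
      using K by (intro \<Phi>_dist perm permutes_compose) auto
    also have "\<dots> = 1 - ?a - ?b + ?a * ?b" by (simp add: algebra_simps)
    also have "\<dots> \<ge> 1 - ?a - ?b"
      by (simp add: hamming_dist_bounds)
    finally have "hamming_dist (n * m) (\<theta> (g \<otimes>\<^bsub>K\<^esub> h)) (\<theta> g \<circ> \<theta> h) \<le> ?a + ?b" by linarith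
    moreover have "?a < \<epsilon> / 2" "?b < \<epsilon> / 2"
      using \<phi>_mult \<psi>_mult gh K by auto
    ultimately show ?thesis by linarith
  qed
  moreover have "hamming_dist (n * m) (\<theta> g) id > 1 - \<epsilon>" if g: "g \<in> F" "g \<noteq> \<one>\<^bsub>K\<^esub>" for g
  proof -
    have K: "g \<in> carrier K" using g F by auto
    let ?a = "hamming_dist n (\<phi> (p g)) id" and ?b = "hamming_dist m (\<psi> (q g)) id"
    have "1 - hamming_dist (n * m) (\<theta> g) id = (1 - ?a) * (1 - ?b)"
      using \<Phi>_dist[OF perm[OF K] permutes_id permutes_id] by (simp add: \<theta>_def \<Phi>_id)
    moreover have "(1 - ?a) * (1 - ?b) \<le> 1 - ?a" "(1 - ?a) * (1 - ?b) \<le> 1 - ?b"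
      by (rule mult_right_le_one_le mult_left_le_one_le; simp add: hamming_dist_bounds)+
    moreover have "p g \<noteq> \<one>\<^bsub>G\<^esub> \<or> q g \<noteq> \<one>\<^bsub>H\<^esub>"
      using eqI[of g "\<one>\<^bsub>K\<^esub>"] g K by auto
    then have "?a > 1 - \<epsilon> / 2 \<or> ?b > 1 - \<epsilon> / 2"
      using \<phi>_free \<psi>_free g by auto
    ultimately show ?thesis using \<epsilon> by linarith
  qed
  moreover have "\<theta> \<in> carrier K \<rightarrow> carrier (sym_group (n * m))"
    using \<Phi> perm by (auto simp: sym_group_carrier \<theta>_def)
  ultimately show "\<exists>n>0. \<exists>\<phi> \<in> carrier K \<rightarrow> carrier (sym_group n).
     (\<forall>g\<in>F. \<forall>h\<in>F. hamming_dist n (\<phi> (g \<otimes>\<^bsub>K\<^esub> h)) (\<phi> g \<circ> \<phi> h) < \<epsilon>) \<and>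
     (\<forall>g\<in>F. g \<noteq> \<one>\<^bsub>K\<^esub> \<longrightarrow> hamming_dist n (\<phi> g) id > 1 - \<epsilon>)"
    using n m by (intro exI[of _ "n * m"] conjI bexI[of _ \<theta>]) auto
qed

section \<open>Comeagerness\<close>

lemma open_fun_finite_window:
  fixes U :: "('i \<Rightarrow> 'a::topological_space) set"
  assumes "open U" "f \<in> U"
  obtains A where "finite A" "\<And>g. (\<And>x. x \<in> A \<Longrightarrow> g x = f x) \<Longrightarrow> g \<in> U"
proof -
  obtain X where X: "f \<in> (\<Pi>\<^sub>E i\<in>UNIV. X i)" "finite {i. X i \<noteq> UNIV}" "(\<Pi>\<^sub>E i\<in>UNIV. X i) \<subseteq> U"
    using product_topology_open_contains_basis[of "\<lambda>_. euclidean" UNIV U f] assms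
    by (auto simp: open_fun_def)
  have "g \<in> U" if "\<And>x. x \<in> {i. X i \<noteq> UNIV} \<Longrightarrow> g x = f x" for g
  proof -
    have "g i \<in> X i" for i
      using X(1) that[of i] by (cases "X i = UNIV") (auto simp: PiE_iff)
    then show ?thesis using X(3) by (auto simp: PiE_iff)
  qed
  with X(2) show thesis by (rule that)
qed

lemma open_enum_structure_finite_window:
  fixes V :: "enum_structure set"
  assumes "open V" "s \<in> V"
  obtains A where "finite A"
    "\<And>t. (\<And>x y. x \<in> A \<Longrightarrow> y \<in> A \<Longrightarrow> fst t (x, y) = fst s (x, y)) \<Longrightarrow>
      (\<And>x. x \<in> A \<Longrightarrow> fst (snd t) x = fst (snd s) x) \<Longrightarrow> snd (snd t) = snd (snd s) \<Longrightarrow> t \<in> V"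
proof -
  obtain M W where MW: "open M" "open W" "s \<in> M \<times> W" "M \<times> W \<subseteq> V"
    using open_prod_elim[OF assms] .
  then have "snd s \<in> W" by (auto simp: mem_Times_iff)
  then obtain J C where JC: "open J" "open C" "snd s \<in> J \<times> C" "J \<times> C \<subseteq> W"
    using open_prod_elim[OF \<open>open W\<close>] by metis
  obtain A1 where A1: "finite A1" "\<And>g. (\<And>x. x \<in> A1 \<Longrightarrow> g x = fst s x) \<Longrightarrow> g \<in> M"
    using open_fun_finite_window[OF MW(1), of "fst s"] MW(3) by (auto simp: mem_Times_iff)
  obtain A2 where A2: "finite A2" "\<And>g. (\<And>x. x \<in> A2 \<Longrightarrow> g x = fst (snd s) x) \<Longrightarrow> g \<in> J"
    using open_fun_finite_window[OF JC(1), of "fst (snd s)"] JC(3) by (auto simp: mem_Times_iff)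
  show thesis
  proof (rule that[of "fst ` A1 \<union> snd ` A1 \<union> A2"])
    fix t :: enum_structure
    assume t: "\<And>x y. x \<in> fst ` A1 \<union> snd ` A1 \<union> A2 \<Longrightarrow> y \<in> fst ` A1 \<union> snd ` A1 \<union> A2 \<Longrightarrow>
        fst t (x, y) = fst s (x, y)"
      "\<And>x. x \<in> fst ` A1 \<union> snd ` A1 \<union> A2 \<Longrightarrow> fst (snd t) x = fst (snd s) x"
      "snd (snd t) = snd (snd s)"
    have "fst t x = fst s x" if "x \<in> A1" for x
      using t(1)[of "fst x" "snd x"] that by (simp add: image_eqI)
    then have "fst t \<in> M" by (rule A1)
    moreover have "fst (snd t) \<in> J" by (rule A2) (rule t(2), simp)
    ultimately show "t \<in> V"
      using MW(4) JC(3,4) t(3) by (cases t) (auto simp: mem_Times_iff subset_iff)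
  qed (use A1 A2 in auto)
qed

text \<open>
  The dense open sets are the sets of groups that solve a given finite system, for the systems that
  are solvable in some group with the property.
\<close>

lemma comeager_locally_universal_if_product_closed:
  assumes closed: "\<And>K G H :: nat monoid. \<And>p q. direct_decomposition K G H p q \<Longrightarrow> P G \<Longrightarrow> P H \<Longrightarrow> P K"
  shows "comeager_in (top_of_set (enumerated_groups_with P)) (locally_universal_groups P)"
proof -
  define S where "S = enumerated_groups_with P"
  define Sys where "Sys = {(E, I). finite E \<and> finite I \<and> (\<exists>g\<in>S. solvable_in E I (to_group g))}"
  define V where "V = (\<lambda>(E, I). S \<inter> {s. solvable_in E I (to_group s)})"
  have "countable (Collect (finite :: (nat \<times> nat \<times> nat) set \<Rightarrow> bool) \<times>
      Collect (finite :: nat set \<Rightarrow> bool))"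
    by (intro countable_SIGMA countable_Collect_finite)
  then have "countable Sys"
    by (rule countable_subset[rotated]) (auto simp: Sys_def)
  then have "countable (V ` Sys)" by simp
  moreover have "openin (top_of_set S) (V c)" if "c \<in> Sys" for c
    using that by (auto simp: Sys_def V_def intro!: openin_open_Int open_solvable_in)
  moreover have "(top_of_set S) closure_of (V c) = topspace (top_of_set S)" if "c \<in> Sys" for c
  proof -
    obtain E I g where c: "c = (E, I)" and "finite E" "finite I" and g: "g \<in> S"
      and sol: "solvable_in E I (to_group g)"
      using \<open>c \<in> Sys\<close> by (auto simp: Sys_def)
    have "\<exists>t\<in>S. solvable_in E I (to_group t) \<and> t \<in> T"
      if T: "open T" "s \<in> T" and s: "s \<in> S" for T s
    proof -
      have sg: "s \<in> enumerated_groups" "g \<in> enumerated_groups" "P (to_group s)" "P (to_group g)"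
        using s g by (auto simp: S_def enumerated_groups_with_def)
      obtain A where A: "finite A"
        "\<And>t. (\<And>x y. x \<in> A \<Longrightarrow> y \<in> A \<Longrightarrow> fst t (x, y) = fst s (x, y)) \<Longrightarrow>
          (\<And>x. x \<in> A \<Longrightarrow> fst (snd t) x = fst (snd s) x) \<Longrightarrow> snd (snd t) = snd (snd s) \<Longrightarrow> t \<in> T"
        using open_enum_structure_finite_window[OF T] by metis
      obtain t p q where t: "t \<in> enumerated_groups"
        "direct_decomposition (to_group t) (to_group s) (to_group g) p q" "t \<in> T"
        using enumerate_product[OF sg(1,2) A(1)] A(2) by metis
      have "t \<in> S"
        using closed[OF t(2) sg(3,4)] t(1) by (simp add: S_def enumerated_groups_with_def)
      then show ?thesis
        using direct_decomposition.solvable_in_product[OF t(2) sol] t(3) by blast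
    qed
    then have "\<exists>t\<in>V c. t \<in> T" if "openin (top_of_set S) T" "s \<in> T" for T s
      using that unfolding openin_open V_def c by blast
    then have "S \<subseteq> (top_of_set S) closure_of (V c)"
      unfolding in_closure_of subset_iff topspace_euclidean_subtopology by blast
    then show ?thesis
      using closure_of_subset_topspace by (metis topspace_euclidean_subtopology subset_antisym)
  qed
  moreover have "S \<inter> \<Inter> (V ` Sys) \<subseteq> locally_universal_groups P"
  proof
    fix h assume h: "h \<in> S \<inter> \<Inter> (V ` Sys)"
    then have "h \<in> enumerated_groups" by (simp add: S_def enumerated_groups_with_def)
    then have "locally_universal P h"
    proof (rule locally_universal_if_solvable)
      fix E I g
      assume "finite E" "finite I" "g \<in> enumerated_groups_with P" "solvable_in E I (to_group g)"
      then have "(E, I) \<in> Sys" unfolding Sys_def S_def by blast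
      then have "h \<in> V (E, I)" using h by blast
      then show "solvable_in E I (to_group h)" by (simp add: V_def)
    qed
    then show "h \<in> locally_universal_groups P"
      using h by (simp add: locally_universal_groups_def S_def)
  qed
  moreover have "locally_universal_groups P \<subseteq> S"
    by (auto simp: locally_universal_groups_def S_def)
  ultimately show ?thesis
    unfolding comeager_in_def S_def[symmetric] topspace_euclidean_subtopology
    by (intro conjI exI[of _ "V ` Sys"] ballI) blast+
qed

theorem theorem1p2p3:
  fixes P :: "nat monoid \<Rightarrow> bool"
  assumes "P \<in> group_properties"
  shows "comeager_in (top_of_set (enumerated_groups_with P)) (locally_universal_groups P)"
proof (rule comeager_locally_universal_if_product_closed)
  fix K G H :: "nat monoid" and p q
  assume "direct_decomposition K G H p q" and "P G" "P H"
  then interpret direct_decomposition K G H p q by simp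
  show "P K"
    using assms \<open>P G\<close> \<open>P H\<close> unfolding group_properties_def
    by (auto intro: amenable_product no_free_subgroup_product left_orderable_product
      locally_indicable_product biorderable_product unique_product_product torsion_free_product
      sofic_product satisfies_no_law_product)
qed

end
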